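(* A ring $R$ is strongly 2-nil-clean if and only if (1) $R$ is an exchange ring, and (2) the square of every unit in $R$ is unipotent.
   Context: All rings are associative with an identity, not necessarily commutative. A ring $R$ is strongly 2-nil-clean if every element of $R$ is the sum of two idempotents and a nilpotent that (pairwise) commute. A ring $R$ is an exchange ring if for any $a\in R$ there exists an idempotent $e\in R$ such that $e\in aR$ and $1-e\in (1-a)R$. An element $u$ of a ring is unipotent if $u-1$ is nilpotent. *)

theory Defs
  imports "HOL-Algebra.Algebra"
begin

text \<open>
  The locale \<^locale>\<open>ring\<close> describes associative rings with identity, not assumed
  commutative; the zero ring is allowed.
\<close>

definition idempotent_elem :: "('a, 'b) ring_scheme \<Rightarrow> 'a \<Rightarrow> bool" where
  "idempotent_elem R e \<longleftrightarrow> e \<in> carrier R \<and> e \<otimes>\<^bsub>R\<^esub> e = e"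

definition nilpotent_elem :: "('a, 'b) ring_scheme \<Rightarrow> 'a \<Rightarrow> bool" where
  "nilpotent_elem R x \<longleftrightarrow> x \<in> carrier R \<and> (\<exists>n::nat. n > 0 \<and> x [^]\<^bsub>R\<^esub> n = \<zero>\<^bsub>R\<^esub>)"

definition unipotent_elem :: "('a, 'b) ring_scheme \<Rightarrow> 'a \<Rightarrow> bool" where
  "unipotent_elem R u \<longleftrightarrow> u \<in> carrier R \<and> nilpotent_elem R (u \<ominus>\<^bsub>R\<^esub> \<one>\<^bsub>R\<^esub>)"

definition strongly_2_nil_clean :: "('a, 'b) ring_scheme \<Rightarrow> bool" where
  "strongly_2_nil_clean R \<longleftrightarrow>
     (\<forall>a \<in> carrier R. \<exists>e f w.
        idempotent_elem R e \<and> idempotent_elem R f \<and> nilpotent_elem R w \<and>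
        e \<otimes>\<^bsub>R\<^esub> f = f \<otimes>\<^bsub>R\<^esub> e \<and> e \<otimes>\<^bsub>R\<^esub> w = w \<otimes>\<^bsub>R\<^esub> e \<and> f \<otimes>\<^bsub>R\<^esub> w = w \<otimes>\<^bsub>R\<^esub> f \<and>
        a = e \<oplus>\<^bsub>R\<^esub> f \<oplus>\<^bsub>R\<^esub> w)"

text \<open>The principal right ideal \<open>aR\<close> is the multiplicative left translate of the carrier by \<open>a\<close>.\<close>

definition exchange_ring :: "('a, 'b) ring_scheme \<Rightarrow> bool" where
  "exchange_ring R \<longleftrightarrow>
     (\<forall>a \<in> carrier R. \<exists>e.
        idempotent_elem R e \<and>
        e \<in> a <#\<^bsub>R\<^esub> carrier R \<and>
        \<one>\<^bsub>R\<^esub> \<ominus>\<^bsub>R\<^esub> e \<in> (\<one>\<^bsub>R\<^esub> \<ominus>\<^bsub>R\<^esub> a) <#\<^bsub>R\<^esub> carrier R)"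

end

theory Submission
  imports Defs
begin

text \<open>
  Both conditions are equivalent to a third one: \<open>a\<^sup>3 - a\<close> is nilpotent for every \<open>a\<close>.

  If \<open>a = e + f + w\<close> is a strongly 2-nil-clean decomposition, then \<open>a\<^sup>3 - a = 6ef + w(\<dots>)\<close>, and
  decomposing the element \<open>-1\<close> shows that \<open>6\<close> is nilpotent. Conversely, if all \<open>a\<^sup>3 - a\<close> are
  nilpotent, then so is \<open>6 = 2\<^sup>3 - 2\<close>, and \<open>a\<^sup>2\<close> and \<open>a - a\<^sup>2\<close> are idempotent modulo nilpotents
  of a commutative subring containing \<open>a\<close>. Lifting these two idempotents decomposes \<open>a\<close>. In the same
  way \<open>a\<^sup>2\<close> lifts to an idempotent witnessing the exchange property, and for a unit \<open>u\<close> the element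
  \<open>u\<^sup>2 - 1\<close> is a multiple of \<open>u\<^sup>3 - u\<close> by a unit that commutes with it.

  The substantial part is to derive the third condition for an exchange ring in which squares of units
  are unipotent. The key is the two-by-two matrix with rows \<open>(1, 1)\<close> and \<open>(1, 0)\<close>: it is a unit, and
  its square minus the identity is again this unit, so it is not nilpotent. Hence no nonzero corner of
  such a ring is a ring of two-by-two matrices. A nonzero idempotent in \<open>xR\<close> with \<open>x\<^sup>2 = 0\<close> would
  produce such a corner (\<open>idempotent_product_eq_zero\<close>). By the exchange property, all square-zero elements
  therefore lie in the Jacobson radical \<open>J\<close> (\<open>square_zero_in_jacobson\<close>). Both hypotheses pass to
  \<open>R/J\<close>, whose radical is zero, so \<open>R/J\<close> is reduced and its idempotents are central. There an exchange
  idempotent of \<open>a\<close> splits the ring into a factor with \<open>a\<^sup>2 = 1\<close> and one with \<open>(1 - a)\<^sup>2 = 1\<close>,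
  from which \<open>a\<^sup>3 = a\<close> follows (\<open>cube_eq_self_of_reduced_exchange\<close>). Finally \<open>J\<close> is nil, because
  \<open>1 + j\<close> and \<open>1 + 2j\<close> are units for \<open>j\<close> in \<open>J\<close> (\<open>nilpotent_of_jacobson\<close>); thus \<open>a\<^sup>3 - a\<close>,
  which lies in \<open>J\<close>, is nilpotent.
\<close>

section \<open>Nilpotent elements of commutative rings\<close>

lemma (in cring) nilpotent_mult:
  assumes "nilpotent_elem R x" "y \<in> carrier R"
  shows "nilpotent_elem R (x \<otimes> y)"
proof -
  obtain n :: nat where "n > 0" "x [^] n = \<zero>" "x \<in> carrier R"
    using assms(1) unfolding nilpotent_elem_def by blast
  then have "(x \<otimes> y) [^] n = \<zero>" using assms(2) by (simp add: nat_pow_distrib)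
  then show ?thesis
    using \<open>n > 0\<close> \<open>x \<in> carrier R\<close> assms(2) unfolding nilpotent_elem_def by blast
qed

text \<open>
  The binomial theorem in disguise. Carrying the factor \<open>z\<close> along lets the proof peel off one factor
  \<open>x \<oplus> y\<close> at a time: it is absorbed into \<open>z\<close> either as \<open>x\<close> or as \<open>y\<close>, which lowers one of
  the two exponents.
\<close>

lemma (in cring) nilpotent_add_aux:
  assumes "x \<in> carrier R" "y \<in> carrier R" "z \<in> carrier R"
    and "z \<otimes> x [^] (m::nat) = \<zero>" "z \<otimes> y [^] (n::nat) = \<zero>"
  shows "z \<otimes> (x \<oplus> y) [^] (m + n) = \<zero>"
  using assms
proof (induction "m + n" arbitrary: m n z)
  case 0
  then show ?case by simp
next
  case (Suc k)
  have split: "z \<otimes> (x \<oplus> y) [^] (m + n) = (z \<otimes> x) \<otimes> (x \<oplus> y) [^] k \<oplus> (z \<otimes> y) \<otimes> (x \<oplus> y) [^] k"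
  proof -
    have "(x \<oplus> y) [^] k \<in> carrier R" using Suc.prems by simp
    then show ?thesis
      using Suc.prems(1-3) unfolding Suc.hyps(2)[symmetric] nat_pow_Suc by algebra
  qed
  show ?case
  proof (cases "m = 0 \<or> n = 0")
    case True
    then have "z = \<zero>" using Suc.prems by auto
    then show ?thesis using Suc.prems by simp
  next
    case False
    then obtain m' n' where m: "m = Suc m'" and n: "n = Suc n'" by (meson not0_implies_Suc)
    have "(z \<otimes> x) \<otimes> (x \<oplus> y) [^] k = \<zero>"
    proof -
      have "(z \<otimes> x) \<otimes> y [^] n = x \<otimes> (z \<otimes> y [^] n)"
        using Suc.prems(1-3) by (simp add: m_ac)
      moreover have "(z \<otimes> x) \<otimes> x [^] m' = \<zero>"
        using Suc.prems m by (simp add: m_ac)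
      ultimately show ?thesis
        using Suc.hyps(1)[of m' n "z \<otimes> x"] Suc.hyps(2) Suc.prems m by simp
    qed
    moreover have "(z \<otimes> y) \<otimes> (x \<oplus> y) [^] k = \<zero>"
    proof -
      have "(z \<otimes> y) \<otimes> x [^] m = y \<otimes> (z \<otimes> x [^] m)"
        using Suc.prems(1-3) by (simp add: m_ac)
      moreover have "(z \<otimes> y) \<otimes> y [^] n' = \<zero>"
        using Suc.prems n by (simp add: m_ac)
      ultimately show ?thesis
        using Suc.hyps(1)[of m n' "z \<otimes> y"] Suc.hyps(2) Suc.prems n by simp
    qed
    ultimately show ?thesis unfolding split by simp
  qed
qed

lemma (in cring) nilpotent_add:
  assumes "nilpotent_elem R x" "nilpotent_elem R y"
  shows "nilpotent_elem R (x \<oplus> y)"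
proof -
  obtain m n :: nat where "x [^] m = \<zero>" "y [^] n = \<zero>" "m > 0"
    and xy: "x \<in> carrier R" "y \<in> carrier R"
    using assms unfolding nilpotent_elem_def by blast
  then have "\<one> \<otimes> (x \<oplus> y) [^] (m + n) = \<zero>"
    by (intro nilpotent_add_aux) auto
  with \<open>m > 0\<close> xy show ?thesis
    unfolding nilpotent_elem_def by (auto intro!: exI[of _ "m + n"])
qed

lemma (in cring) nilpotent_uminus:
  assumes "nilpotent_elem R x"
  shows "nilpotent_elem R (\<ominus> x)"
proof -
  have "x \<in> carrier R" using assms by (simp add: nilpotent_elem_def)
  then have "\<ominus> x = x \<otimes> \<ominus> \<one>" by algebra
  then show ?thesis using nilpotent_mult[OF assms, of "\<ominus> \<one>"] by simp
qed

lemma (in cring) nilpotent_diff: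
  assumes "nilpotent_elem R x" "nilpotent_elem R y"
  shows "nilpotent_elem R (x \<ominus> y)"
  using nilpotent_add nilpotent_uminus assms by (simp add: a_minus_def)

lemma (in monoid) square_nat_pow:
  assumes "x \<in> carrier G"
  shows "(x \<otimes> x) [^] (n::nat) = x [^] (2 * n)"
  using assms nat_pow_pow[of x 2 n] by (simp add: numeral_2_eq_2)

lemma (in ring) nilpotent_of_square:
  assumes "nilpotent_elem R (x \<otimes> x)" "x \<in> carrier R"
  shows "nilpotent_elem R x"
  using assms square_nat_pow[OF assms(2)] unfolding nilpotent_elem_def
  by (metis nat_0_less_mult_iff zero_less_numeral)

text \<open>
  For commuting idempotents, \<open>x = e \<oplus> f\<close> satisfies \<open>x\<^sup>3 - x = 6ef\<close>; the remaining terms of the cube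
  of \<open>x \<oplus> w\<close> are multiples of \<open>w\<close>.
\<close>

lemma (in cring) two_idempotents_cube:
  assumes e: "idempotent_elem R e" and f: "idempotent_elem R f" and w: "nilpotent_elem R w"
    and six: "nilpotent_elem R ((\<one> \<oplus> \<one>) \<otimes> (\<one> \<oplus> \<one> \<oplus> \<one>))"
    and a: "a = e \<oplus> f \<oplus> w"
  shows "nilpotent_elem R (a \<otimes> a \<otimes> a \<ominus> a)"
proof -
  have c: "e \<in> carrier R" "f \<in> carrier R" "w \<in> carrier R" and i: "e \<otimes> e = e" "f \<otimes> f = f"
    using assms by (auto simp: idempotent_elem_def nilpotent_elem_def)
  have i': "e \<otimes> (e \<otimes> f) = e \<otimes> f" using c i by (simp flip: m_assoc)
  define x where "x = e \<oplus> f"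
  have x: "x \<in> carrier R" using c by (simp add: x_def)
  have xx: "x \<otimes> x = x \<oplus> (\<one> \<oplus> \<one>) \<otimes> (e \<otimes> f)"
    unfolding x_def using c i i' by algebra
  have "x \<otimes> (e \<otimes> f) = e \<otimes> f \<oplus> e \<otimes> f"
    unfolding x_def using c i i' by algebra
  then have xxx: "x \<otimes> x \<otimes> x = x \<oplus> (\<one> \<oplus> \<one>) \<otimes> (\<one> \<oplus> \<one> \<oplus> \<one>) \<otimes> (e \<otimes> f)"
    using x c xx by algebra
  have "a \<otimes> a \<otimes> a \<ominus> a = (x \<otimes> x \<otimes> x \<ominus> x) \<oplus> w \<otimes> ((\<one> \<oplus> \<one> \<oplus> \<one>) \<otimes> (x \<otimes> x) \<oplus> (\<one> \<oplus> \<one> \<oplus> \<one>) \<otimes> x \<otimes> w \<oplus> w \<otimes> w \<ominus> \<one>)"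
    unfolding a x_def[symmetric] using x c by algebra
  also have "x \<otimes> x \<otimes> x \<ominus> x = (\<one> \<oplus> \<one>) \<otimes> (\<one> \<oplus> \<one> \<oplus> \<one>) \<otimes> (e \<otimes> f)"
    unfolding xxx using x c by algebra
  finally show ?thesis
    using six w x c by (simp add: nilpotent_add nilpotent_mult del: l_one r_one)
qed

text \<open>
  The sum \<open>x = e \<oplus> f\<close> is a root of \<open>X(X - 1)(X - 2)\<close>. Modulo \<open>w\<close> it equals \<open>-1\<close>, where that
  polynomial takes the value \<open>-6\<close>.
\<close>

lemma (in cring) six_nilpotent:
  assumes e: "idempotent_elem R e" and f: "idempotent_elem R f" and w: "nilpotent_elem R w"
    and a: "\<ominus> \<one> = e \<oplus> f \<oplus> w"
  shows "nilpotent_elem R ((\<one> \<oplus> \<one>) \<otimes> (\<one> \<oplus> \<one> \<oplus> \<one>))"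
proof -
  have c: "e \<in> carrier R" "f \<in> carrier R" "w \<in> carrier R" and i: "e \<otimes> e = e" "f \<otimes> f = f"
    using assms by (auto simp: idempotent_elem_def nilpotent_elem_def)
  have i': "e \<otimes> (e \<otimes> f) = e \<otimes> f" using c i by (simp flip: m_assoc)
  define x where "x = e \<oplus> f"
  have x: "x \<in> carrier R" using c by (simp add: x_def)
  have z: "x \<otimes> ((x \<ominus> \<one>) \<otimes> (x \<ominus> \<one> \<ominus> \<one>)) = \<zero>"
    unfolding x_def using c i i' by algebra
  have "x = x \<oplus> w \<oplus> \<ominus> w" using x c by algebra
  also have "\<dots> = \<ominus> \<one> \<ominus> w" using a by (simp add: x_def a_minus_def)
  finally have xw: "x = \<ominus> \<one> \<ominus> w" .
  define s t where "s = \<one> \<oplus> \<one>" and "t = \<one> \<oplus> \<one> \<oplus> \<one>"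
  have st: "s \<in> carrier R" "t \<in> carrier R" by (auto simp: s_def t_def)
  have "x = \<ominus> (\<one> \<oplus> w)" "x \<ominus> \<one> = \<ominus> (s \<oplus> w)" "x \<ominus> \<one> \<ominus> \<one> = \<ominus> (t \<oplus> w)"
    unfolding xw s_def t_def using c by algebra+
  then have "\<ominus> (\<one> \<oplus> w) \<otimes> (\<ominus> (s \<oplus> w) \<otimes> \<ominus> (t \<oplus> w)) = \<zero>" using z by simp
  moreover have "s \<otimes> t = w \<otimes> (\<ominus> ((\<one> \<oplus> w) \<otimes> (s \<oplus> t \<oplus> w) \<oplus> s \<otimes> t))
      \<ominus> \<ominus> (\<one> \<oplus> w) \<otimes> (\<ominus> (s \<oplus> w) \<otimes> \<ominus> (t \<oplus> w))"
    using c st by algebra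
  ultimately have "s \<otimes> t = w \<otimes> (\<ominus> ((\<one> \<oplus> w) \<otimes> (s \<oplus> t \<oplus> w) \<oplus> s \<otimes> t))"
    using c st by (simp add: a_minus_def)
  then have "nilpotent_elem R (s \<otimes> t)"
    using nilpotent_mult[OF w, of "\<ominus> ((\<one> \<oplus> w) \<otimes> (s \<oplus> t \<oplus> w) \<oplus> s \<otimes> t)"] c st by simp
  then show ?thesis unfolding s_def t_def .
qed

section \<open>Idempotents and cubes in commutative rings\<close>

lemma (in cring) comaximal_powers:
  assumes b: "b \<in> carrier R" and c: "c \<in> carrier R" and "b \<oplus> c = \<one>"
  shows "\<exists>r \<in> carrier R. \<exists>s \<in> carrier R. b [^] (n::nat) \<otimes> r \<oplus> c [^] n \<otimes> s = \<one>"
proof -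
  have step: "\<exists>r \<in> carrier R. \<exists>s \<in> carrier R. x \<otimes> r \<oplus> (y \<otimes> z) \<otimes> s = \<one>"
    if "x \<in> carrier R" "y \<in> carrier R" "z \<in> carrier R"
      and "\<exists>r \<in> carrier R. \<exists>s \<in> carrier R. x \<otimes> r \<oplus> y \<otimes> s = \<one>"
      and "\<exists>r \<in> carrier R. \<exists>s \<in> carrier R. x \<otimes> r \<oplus> z \<otimes> s = \<one>" for x y z
  proof -
    obtain r s r' s' where rs: "r \<in> carrier R" "s \<in> carrier R" "r' \<in> carrier R" "s' \<in> carrier R"
      and eq: "x \<otimes> r \<oplus> y \<otimes> s = \<one>" "x \<otimes> r' \<oplus> z \<otimes> s' = \<one>"
      using \<open>\<exists>r \<in> carrier R. \<exists>s \<in> carrier R. x \<otimes> r \<oplus> y \<otimes> s = \<one>\<close>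
        \<open>\<exists>r \<in> carrier R. \<exists>s \<in> carrier R. x \<otimes> r \<oplus> z \<otimes> s = \<one>\<close> by blast
    have "x \<otimes> (r \<otimes> (x \<otimes> r' \<oplus> z \<otimes> s') \<oplus> y \<otimes> s \<otimes> r') \<oplus> (y \<otimes> z) \<otimes> (s \<otimes> s')
        = (x \<otimes> r \<oplus> y \<otimes> s) \<otimes> (x \<otimes> r' \<oplus> z \<otimes> s')"
      using that(1-3) rs by algebra
    also have "\<dots> = \<one>" unfolding eq by simp
    finally have "x \<otimes> (r \<otimes> (x \<otimes> r' \<oplus> z \<otimes> s') \<oplus> y \<otimes> s \<otimes> r') \<oplus> (y \<otimes> z) \<otimes> (s \<otimes> s') = \<one>" .
    moreover have "r \<otimes> (x \<otimes> r' \<oplus> z \<otimes> s') \<oplus> y \<otimes> s \<otimes> r' \<in> carrier R" "s \<otimes> s' \<in> carrier R"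
      using rs that(1-3) by auto
    ultimately show ?thesis by blast
  qed
  have pow: "\<exists>r \<in> carrier R. \<exists>s \<in> carrier R. x \<otimes> r \<oplus> y [^] (n::nat) \<otimes> s = \<one>"
    if "x \<in> carrier R" "y \<in> carrier R"
      and "\<exists>r \<in> carrier R. \<exists>s \<in> carrier R. x \<otimes> r \<oplus> y \<otimes> s = \<one>" for x y n
  proof (induction n)
    case 0
    have "x \<otimes> \<zero> \<oplus> y [^] (0::nat) \<otimes> \<one> = \<one>" using that by simp
    then show ?case by blast
  next
    case (Suc n)
    then show ?case using step[of x "y [^] n" y] that by simp
  qed
  have swap: "\<exists>r \<in> carrier R. \<exists>s \<in> carrier R. y \<otimes> r \<oplus> x \<otimes> s = \<one>"
    if "x \<in> carrier R" "y \<in> carrier R"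
      and "\<exists>r \<in> carrier R. \<exists>s \<in> carrier R. x \<otimes> r \<oplus> y \<otimes> s = \<one>" for x y
    using that a_comm[OF m_closed m_closed] by metis
  have "b \<otimes> \<one> \<oplus> c \<otimes> \<one> = \<one>" using assms by simp
  then have "\<exists>r \<in> carrier R. \<exists>s \<in> carrier R. b \<otimes> r \<oplus> c \<otimes> s = \<one>" by blast
  from pow[OF b c this, of n]
  have "\<exists>r \<in> carrier R. \<exists>s \<in> carrier R. c [^] n \<otimes> r \<oplus> b \<otimes> s = \<one>"
    using swap[of b "c [^] n"] b c by simp
  from pow[OF _ b this, of n] show ?thesis
    using swap[of "c [^] n" "b [^] n"] b c by simp
qed

text \<open>
  If \<open>b\<^sup>n(1 - b)\<^sup>n = 0\<close>, then the comaximal elements \<open>b\<^sup>n\<close> and \<open>(1 - b)\<^sup>n\<close> split the ring as a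
  product, and \<open>e\<close> is the idempotent of the factor in which \<open>b\<close> is invertible. This one idempotent
  provides both the exchange property and the lifting of idempotents modulo nilpotents.
\<close>

lemma (in cring) idempotent_of_nilpotent_defect:
  assumes b: "b \<in> carrier R" and nil: "nilpotent_elem R (b \<otimes> (\<one> \<ominus> b))"
  obtains e r s where "idempotent_elem R e" "r \<in> carrier R" "s \<in> carrier R"
    "e = b \<otimes> r" "\<one> \<ominus> e = (\<one> \<ominus> b) \<otimes> s"
proof -
  define c where "c = \<one> \<ominus> b"
  have c: "c \<in> carrier R" using b by (simp add: c_def)
  obtain n where "(b \<otimes> c) [^] Suc n = \<zero>"
    using nil unfolding nilpotent_elem_def c_def by (metis gr0_conv_Suc)
  then have bc: "b [^] Suc n \<otimes> c [^] Suc n = \<zero>"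
    using b c nat_pow_distrib by metis
  have sum1: "b \<oplus> c = \<one>" using b unfolding c_def by algebra
  obtain r s where rs: "r \<in> carrier R" "s \<in> carrier R"
    and one: "b [^] Suc n \<otimes> r \<oplus> c [^] Suc n \<otimes> s = \<one>"
    using comaximal_powers[OF b c sum1, of "Suc n"] by blast
  define e d where "e = b [^] Suc n \<otimes> r" and "d = c [^] Suc n \<otimes> s"
  have ed: "e \<in> carrier R" "d \<in> carrier R" using b c rs by (auto simp: e_def d_def)
  have sum: "e \<oplus> d = \<one>" using one by (simp add: e_def d_def)
  have "e \<otimes> d = (b [^] Suc n \<otimes> c [^] Suc n) \<otimes> (r \<otimes> s)"
    using b c rs unfolding e_def d_def by (simp add: m_ac del: nat_pow_Suc)
  then have ed0: "e \<otimes> d = \<zero>" using bc rs by simp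
  have "e = e \<otimes> (e \<oplus> d)" using sum ed by simp
  also have "\<dots> = e \<otimes> e" using ed ed0 by (simp add: r_distr)
  finally have "idempotent_elem R e" using ed by (simp add: idempotent_elem_def)
  moreover have "e = b \<otimes> (b [^] n \<otimes> r)"
    using b rs unfolding e_def by (simp add: m_ac)
  moreover have "\<one> \<ominus> e = (\<one> \<ominus> b) \<otimes> (c [^] n \<otimes> s)"
  proof -
    have "\<one> \<ominus> e = (e \<oplus> d) \<ominus> e" using sum by simp
    also have "\<dots> = d" using ed by algebra
    also have "\<dots> = c \<otimes> (c [^] n \<otimes> s)" using c rs unfolding d_def by (simp add: m_ac)
    finally show ?thesis by (simp add: c_def)
  qed
  ultimately show thesis 
    using that[of e "b [^] n \<otimes> r" "c [^] n \<otimes> s"] b c rs by simp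
qed

lemma (in cring) idempotent_lift:
  assumes b: "b \<in> carrier R" and nil: "nilpotent_elem R (b \<otimes> (\<one> \<ominus> b))"
  obtains e where "idempotent_elem R e" "nilpotent_elem R (b \<ominus> e)"
proof -
  obtain e r s where e: "idempotent_elem R e" and rs: "r \<in> carrier R" "s \<in> carrier R"
    and er: "e = b \<otimes> r" and es: "\<one> \<ominus> e = (\<one> \<ominus> b) \<otimes> s"
    using idempotent_of_nilpotent_defect[OF assms] by blast
  have ec: "e \<in> carrier R" using e by (simp add: idempotent_elem_def)
  have "b \<ominus> e = b \<otimes> (\<one> \<ominus> e) \<ominus> e \<otimes> (\<one> \<ominus> b)" using b ec by algebra
  also have "\<dots> = b \<otimes> ((\<one> \<ominus> b) \<otimes> s) \<ominus> (b \<otimes> r) \<otimes> (\<one> \<ominus> b)" using er es by simp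
  also have "\<dots> = b \<otimes> (\<one> \<ominus> b) \<otimes> (s \<ominus> r)" using b rs by algebra
  finally have "nilpotent_elem R (b \<ominus> e)" using nilpotent_mult[OF nil] rs by simp
  then show thesis using that e by blast
qed

text \<open>
  The square \<open>b = a\<^sup>2\<close> is idempotent modulo nilpotents, since \<open>b(1 - b) = -a(a\<^sup>3 - a)\<close>; and
  \<open>1 - a\<^sup>2\<close> is a multiple of \<open>1 - a\<close>.
\<close>

lemma (in cring) exchange_of_cube:
  assumes a: "a \<in> carrier R" and nil: "nilpotent_elem R (a \<otimes> a \<otimes> a \<ominus> a)"
  obtains e r s where "idempotent_elem R e" "r \<in> carrier R" "s \<in> carrier R"
    "e = a \<otimes> r" "\<one> \<ominus> e = (\<one> \<ominus> a) \<otimes> s"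
proof -
  have "(a \<otimes> a) \<otimes> (\<one> \<ominus> a \<otimes> a) = (a \<otimes> a \<otimes> a \<ominus> a) \<otimes> \<ominus> a" using a by algebra
  then have na: "nilpotent_elem R ((a \<otimes> a) \<otimes> (\<one> \<ominus> a \<otimes> a))"
    using nilpotent_mult[OF nil, of "\<ominus> a"] a by simp
  obtain e r s where e: "idempotent_elem R e" and rs: "r \<in> carrier R" "s \<in> carrier R"
    and er: "e = a \<otimes> a \<otimes> r" and es: "\<one> \<ominus> e = (\<one> \<ominus> a \<otimes> a) \<otimes> s"
    by (rule idempotent_of_nilpotent_defect[OF m_closed[OF a a] na])
  have "e = a \<otimes> (a \<otimes> r)" using er a rs by (simp add: m_assoc)
  moreover have "(\<one> \<ominus> a \<otimes> a) \<otimes> s = (\<one> \<ominus> a) \<otimes> ((\<one> \<oplus> a) \<otimes> s)" using a rs by algebra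
  ultimately show thesis
    using that[of e "a \<otimes> r" "(\<one> \<oplus> a) \<otimes> s"] e es rs a by simp
qed

text \<open>
  The decomposition is \<open>a = a\<^sup>2 + (a - a\<^sup>2)\<close>, corrected by nilpotents. Both summands are idempotent
  modulo nilpotents: for \<open>b = a - a\<^sup>2\<close> one has \<open>b\<^sup>2 = -2b\<close> there, hence \<open>b - b\<^sup>2 = 3b\<close>, and
  \<open>3b\<close> is itself nilpotent because \<open>(3b)\<^sup>2 = -18b\<close> is a multiple of \<open>6\<close>.
\<close>

lemma (in cring) decomposition_of_cube:
  assumes a: "a \<in> carrier R" and nil: "nilpotent_elem R (a \<otimes> a \<otimes> a \<ominus> a)"
    and six: "nilpotent_elem R ((\<one> \<oplus> \<one>) \<otimes> (\<one> \<oplus> \<one> \<oplus> \<one>))"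
  obtains e f w where "idempotent_elem R e" "idempotent_elem R f" "nilpotent_elem R w"
    "a = e \<oplus> f \<oplus> w"
proof -
  define c where "c = a \<otimes> a \<otimes> a \<ominus> a"
  have c: "c \<in> carrier R" using a by (simp add: c_def)
  define b where "b = a \<ominus> a \<otimes> a"
  have b: "b \<in> carrier R" using a by (simp add: b_def)
  have "(a \<otimes> a) \<otimes> (\<one> \<ominus> a \<otimes> a) = c \<otimes> \<ominus> a" unfolding c_def using a by algebra
  then have na: "nilpotent_elem R ((a \<otimes> a) \<otimes> (\<one> \<ominus> a \<otimes> a))"
    using nilpotent_mult[OF nil, of "\<ominus> a"] a by (simp add: c_def)
  define t where "t = \<one> \<oplus> \<one> \<oplus> \<one>"
  have t: "t \<in> carrier R" by (simp add: t_def)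
  have bb: "b \<otimes> b = c \<otimes> (a \<ominus> (\<one> \<oplus> \<one>)) \<ominus> (\<one> \<oplus> \<one>) \<otimes> b"
    unfolding b_def c_def using a by algebra
  have "(t \<otimes> b) \<otimes> (t \<otimes> b) = t \<otimes> t \<otimes> (b \<otimes> b)" using t b by (simp add: m_ac)
  also have "\<dots> = c \<otimes> (t \<otimes> t \<otimes> (a \<ominus> (\<one> \<oplus> \<one>))) \<ominus> ((\<one> \<oplus> \<one>) \<otimes> t) \<otimes> (t \<otimes> b)"
    unfolding bb using t b c a by algebra
  moreover have "nilpotent_elem R \<dots>"
    by (rule nilpotent_diff[OF nilpotent_mult[OF nil[folded c_def]]
          nilpotent_mult[OF six[folded t_def]]]) (use a b t in simp_all)
  ultimately have "nilpotent_elem R ((t \<otimes> b) \<otimes> (t \<otimes> b))" by simp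
  then have n3: "nilpotent_elem R (t \<otimes> b)"
    by (rule nilpotent_of_square) (use b t in simp)
  have "b \<otimes> (\<one> \<ominus> b) = b \<ominus> b \<otimes> b" using b by algebra
  also have "\<dots> = t \<otimes> b \<ominus> c \<otimes> (a \<ominus> (\<one> \<oplus> \<one>))"
    unfolding bb t_def using b c a by algebra
  moreover have "nilpotent_elem R \<dots>"
    by (rule nilpotent_diff[OF n3 nilpotent_mult[OF nil[folded c_def]]]) (use a in simp)
  ultimately have nb: "nilpotent_elem R (b \<otimes> (\<one> \<ominus> b))" by simp
  obtain e where e: "idempotent_elem R e" "nilpotent_elem R (a \<otimes> a \<ominus> e)"
    by (rule idempotent_lift[OF m_closed[OF a a] na])
  obtain f where f: "idempotent_elem R f" "nilpotent_elem R (b \<ominus> f)"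
    by (rule idempotent_lift[OF b nb])
  have ef: "e \<in> carrier R" "f \<in> carrier R" using e f by (auto simp: idempotent_elem_def)
  have "a = e \<oplus> f \<oplus> ((a \<otimes> a \<ominus> e) \<oplus> (b \<ominus> f))"
    unfolding b_def using a ef by algebra
  then show thesis using that[OF e(1) f(1) nilpotent_add[OF e(2) f(2)]] by simp
qed

text \<open>
  The two hypotheses say that \<open>2j + j\<^sup>2\<close> and \<open>4j(1 + j)\<close> are nilpotent. The second one, together
  with the invertibility of \<open>1 + j\<close>, makes \<open>4j\<close> and hence \<open>2j\<close> nilpotent, so that \<open>j\<^sup>2\<close> is nilpotent
  by the first one.
\<close>

lemma (in cring) nilpotent_of_unipotent_squares:
  assumes j: "j \<in> carrier R" and v: "v \<in> carrier R" "(\<one> \<oplus> j) \<otimes> v = \<one>"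
    and n1: "nilpotent_elem R ((\<one> \<oplus> j) \<otimes> (\<one> \<oplus> j) \<ominus> \<one>)"
    and n2: "nilpotent_elem R ((\<one> \<oplus> (j \<oplus> j)) \<otimes> (\<one> \<oplus> (j \<oplus> j)) \<ominus> \<one>)"
  shows "nilpotent_elem R j"
proof -
  have "(\<one> \<oplus> (j \<oplus> j)) \<otimes> (\<one> \<oplus> (j \<oplus> j)) \<ominus> \<one> = ((j \<oplus> j) \<oplus> (j \<oplus> j)) \<otimes> (\<one> \<oplus> j)"
    using j by algebra
  then have "nilpotent_elem R (((j \<oplus> j) \<oplus> (j \<oplus> j)) \<otimes> (\<one> \<oplus> j) \<otimes> v)"
    using n2 v nilpotent_mult by simp
  then have "nilpotent_elem R ((j \<oplus> j) \<oplus> (j \<oplus> j))"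
    using j v by (simp add: m_assoc)
  then have "nilpotent_elem R (((j \<oplus> j) \<oplus> (j \<oplus> j)) \<otimes> j)"
    using j nilpotent_mult by blast
  also have "((j \<oplus> j) \<oplus> (j \<oplus> j)) \<otimes> j = (j \<oplus> j) \<otimes> (j \<oplus> j)" using j by algebra
  finally have "nilpotent_elem R (j \<oplus> j)" by (rule nilpotent_of_square) (use j in simp)
  then have "nilpotent_elem R (((\<one> \<oplus> j) \<otimes> (\<one> \<oplus> j) \<ominus> \<one>) \<ominus> (j \<oplus> j))"
    using nilpotent_diff[OF n1] by blast
  also have "((\<one> \<oplus> j) \<otimes> (\<one> \<oplus> j) \<ominus> \<one>) \<ominus> (j \<oplus> j) = j \<otimes> j" using j by algebra
  finally show ?thesis using j by (rule nilpotent_of_square)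
qed

section \<open>Commutative subrings containing given commuting elements\<close>

definition (in ring) centralizer :: "'a set \<Rightarrow> 'a set" where
  "centralizer S = {x \<in> carrier R. \<forall>s \<in> S. x \<otimes> s = s \<otimes> x}"

lemma (in ring) centralizer_subring:
  assumes "S \<subseteq> carrier R"
  shows "subring (centralizer S) R"
proof (rule subringI)
  fix x y assume xy: "x \<in> centralizer S" "y \<in> centralizer S"
  then have c: "x \<in> carrier R" "y \<in> carrier R" by (auto simp: centralizer_def)
  have "x \<otimes> y \<otimes> s = s \<otimes> (x \<otimes> y)" "(x \<oplus> y) \<otimes> s = s \<otimes> (x \<oplus> y)" if "s \<in> S" for s
  proof -
    have s: "s \<in> carrier R" "x \<otimes> s = s \<otimes> x" "y \<otimes> s = s \<otimes> y"
      using xy that assms by (auto simp: centralizer_def)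
    have "x \<otimes> y \<otimes> s = x \<otimes> (y \<otimes> s)" using c s(1) by (simp add: m_assoc)
    also have "\<dots> = (x \<otimes> s) \<otimes> y" using c s(1) unfolding s(3) by (simp add: m_assoc)
    also have "\<dots> = s \<otimes> (x \<otimes> y)" using c s(1) unfolding s(2) by (simp add: m_assoc)
    finally show "x \<otimes> y \<otimes> s = s \<otimes> (x \<otimes> y)" .
    show "(x \<oplus> y) \<otimes> s = s \<otimes> (x \<oplus> y)" using c s by (simp add: l_distr r_distr)
  qed
  then show "x \<otimes> y \<in> centralizer S" "x \<oplus> y \<in> centralizer S"
    using c by (auto simp: centralizer_def)
next
  fix x assume "x \<in> centralizer S"
  then show "\<ominus> x \<in> centralizer S"
    using assms by (auto simp: centralizer_def subset_iff l_minus r_minus)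
next
  show "\<one> \<in> centralizer S" using assms by (auto simp: centralizer_def)
qed (auto simp: centralizer_def)

text \<open>
  Commuting elements generate a commutative subring. The double centralizer is a convenient such
  subring, because it is defined without polynomials and is closed under existing inverses.
\<close>

lemma (in ring) bicommutant_subcring:
  assumes S: "S \<subseteq> carrier R" and comm: "\<And>s t. s \<in> S \<Longrightarrow> t \<in> S \<Longrightarrow> s \<otimes> t = t \<otimes> s"
  shows "subcring (centralizer (centralizer S)) R"
proof (rule subcringI)
  have sub: "centralizer S \<subseteq> carrier R" by (auto simp: centralizer_def)
  then show "subring (centralizer (centralizer S)) R" by (rule centralizer_subring)
  have "S \<subseteq> centralizer S" using S comm by (auto simp: centralizer_def)
  then have "centralizer (centralizer S) \<subseteq> centralizer S"
    by (auto simp: centralizer_def)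
  then show "x \<otimes> y = y \<otimes> x"
    if "x \<in> centralizer (centralizer S)" "y \<in> centralizer (centralizer S)" for x y
    using that by (auto simp: centralizer_def)
qed

lemma (in ring) subset_bicommutant:
  assumes "S \<subseteq> carrier R"
  shows "S \<subseteq> centralizer (centralizer S)"
  using assms by (auto simp: centralizer_def)

lemma (in ring) bicommutant_inverse:
  assumes u: "u \<in> centralizer (centralizer S)" and v: "v \<in> carrier R" "u \<otimes> v = \<one>" "v \<otimes> u = \<one>"
  shows "v \<in> centralizer (centralizer S)"
proof -
  have uc: "u \<in> carrier R" using u by (simp add: centralizer_def)
  have "v \<otimes> y = y \<otimes> v" if "y \<in> centralizer S" for y
  proof -
    have y: "y \<in> carrier R" "u \<otimes> y = y \<otimes> u" using that u by (auto simp: centralizer_def)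
    have "v \<otimes> y = v \<otimes> (y \<otimes> u) \<otimes> v" using y uc v by (simp add: m_assoc)
    also have "\<dots> = (v \<otimes> u) \<otimes> y \<otimes> v" using y uc v(1) by (simp add: m_assoc flip: y(2))
    also have "\<dots> = y \<otimes> v" using y v by simp
    finally show ?thesis .
  qed
  then show ?thesis using v by (simp add: centralizer_def)
qed

lemma (in ring) subring_minus:
  assumes H: "subring H R" and "x \<in> H" "y \<in> H"
  shows "x \<ominus>\<^bsub>R\<lparr>carrier := H\<rparr>\<^esub> y = x \<ominus> y" "\<ominus>\<^bsub>R\<lparr>carrier := H\<rparr>\<^esub> y = \<ominus> y"
proof -
  interpret H: ring "R\<lparr>carrier := H\<rparr>" using subring_is_ring[OF H] .
  have c: "x \<in> carrier R" "y \<in> carrier R" "\<ominus> y \<in> H" using subringE[OF H] assms by auto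
  show m: "\<ominus>\<^bsub>R\<lparr>carrier := H\<rparr>\<^esub> y = \<ominus> y"
    using H.minus_equality[of "\<ominus> y" y] assms c by (simp add: l_neg)
  show "x \<ominus>\<^bsub>R\<lparr>carrier := H\<rparr>\<^esub> y = x \<ominus> y"
    unfolding a_minus_def m by simp
qed

lemma (in ring) nilpotent_subring:
  assumes "subring H R"
  shows "nilpotent_elem (R\<lparr>carrier := H\<rparr>) x \<longleftrightarrow> x \<in> H \<and> nilpotent_elem R x"
  using subringE(1)[OF assms] by (auto simp: nilpotent_elem_def simp flip: nat_pow_consistent)

lemma (in ring) idempotent_subring:
  assumes "subring H R"
  shows "idempotent_elem (R\<lparr>carrier := H\<rparr>) x \<longleftrightarrow> x \<in> H \<and> idempotent_elem R x"
  using subringE(1)[OF assms] by (auto simp: idempotent_elem_def)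

text \<open>
  All computations with commuting elements of a noncommutative ring are carried out in the commutative
  ring provided here.
\<close>

lemma (in ring) commuting_elements_in_subcring:
  assumes "S \<subseteq> carrier R" "\<And>s t. s \<in> S \<Longrightarrow> t \<in> S \<Longrightarrow> s \<otimes> t = t \<otimes> s"
  obtains H where "subring H R" "S \<subseteq> H" "cring (R\<lparr>carrier := H\<rparr>)"
    "\<And>u. u \<in> H \<Longrightarrow> u \<in> Units R \<Longrightarrow> inv u \<in> H"
proof
  let ?H = "centralizer (centralizer S)"
  have H: "subcring ?H R" using assms by (rule bicommutant_subcring)
  then show "subring ?H R" by (rule subcring.axioms)
  then show "cring (R\<lparr>carrier := ?H\<rparr>)" using H subcring_iff[OF subringE(1)] by blast
  show "S \<subseteq> ?H" using assms(1) by (rule subset_bicommutant)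
  show "inv u \<in> ?H" if "u \<in> ?H" "u \<in> Units R" for u
    using bicommutant_inverse[OF that(1)] that(2) by simp
qed

section \<open>The Jacobson radical\<close>

text \<open>
  The Jacobson radical, described elementwise as the largest right ideal consisting of elements \<open>x\<close>
  with \<open>1 - x\<close> invertible.
\<close>

definition (in ring) jacobson :: "'a set" where
  "jacobson = {x \<in> carrier R. \<forall>r \<in> carrier R. \<one> \<ominus> x \<otimes> r \<in> Units R}"

lemma (in monoid) Units_of_one_sided:
  assumes "x \<in> carrier G" "y \<in> carrier G" "z \<in> carrier G"
    and "y \<otimes> x = \<one>" "x \<otimes> z = \<one>"
  shows "x \<in> Units G"
  using assms inv_unique[of y x z] unfolding Units_def by auto

text \<open>
  Formally, \<open>(1 - ba)\<^sup>-\<^sup>1 = 1 + ba + baba + \<dots> = 1 + b(1 - ab)\<^sup>-\<^sup>1a\<close>. This gives the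
  left-right symmetry of the radical.
\<close>

lemma (in ring) one_minus_swap_Units:
  assumes a: "a \<in> carrier R" and b: "b \<in> carrier R" and u: "\<one> \<ominus> a \<otimes> b \<in> Units R"
  shows "\<one> \<ominus> b \<otimes> a \<in> Units R"
proof -
  obtain v where v: "v \<in> carrier R" "v \<otimes> (\<one> \<ominus> a \<otimes> b) = \<one>" "(\<one> \<ominus> a \<otimes> b) \<otimes> v = \<one>"
    using u unfolding Units_def by blast
  have "(\<one> \<ominus> b \<otimes> a) \<otimes> (\<one> \<oplus> b \<otimes> v \<otimes> a) = \<one> \<ominus> b \<otimes> a \<oplus> b \<otimes> ((\<one> \<ominus> a \<otimes> b) \<otimes> v) \<otimes> a"
    using a b v(1) by (simp add: ring_simprules)
  also have "\<dots> = \<one>" unfolding v using a b by algebra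
  finally have 1: "(\<one> \<ominus> b \<otimes> a) \<otimes> (\<one> \<oplus> b \<otimes> v \<otimes> a) = \<one>" .
  have "(\<one> \<oplus> b \<otimes> v \<otimes> a) \<otimes> (\<one> \<ominus> b \<otimes> a) = \<one> \<ominus> b \<otimes> a \<oplus> b \<otimes> (v \<otimes> (\<one> \<ominus> a \<otimes> b)) \<otimes> a"
    using a b v(1) by (simp add: ring_simprules)
  also have "\<dots> = \<one>" unfolding v using a b by algebra
  finally show ?thesis using 1 a b v(1) unfolding Units_def by auto
qed

lemma (in ring) jacobson_r_closed:
  assumes "x \<in> jacobson" "r \<in> carrier R"
  shows "x \<otimes> r \<in> jacobson"
  using assms by (simp add: jacobson_def m_assoc)

lemma (in ring) jacobson_l_closed:
  assumes x: "x \<in> jacobson" and r: "r \<in> carrier R"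
  shows "r \<otimes> x \<in> jacobson"
proof -
  have "\<one> \<ominus> (r \<otimes> x) \<otimes> s \<in> Units R" if s: "s \<in> carrier R" for s
  proof -
    have "\<one> \<ominus> (x \<otimes> s) \<otimes> r \<in> Units R" using x r s by (simp add: jacobson_def m_assoc)
    then have "\<one> \<ominus> r \<otimes> (x \<otimes> s) \<in> Units R"
      using one_minus_swap_Units x r s by (simp add: jacobson_def)
    then show ?thesis using x r s by (simp add: jacobson_def m_assoc)
  qed
  then show ?thesis using x r by (simp add: jacobson_def)
qed

lemma (in ring) one_add_jacobson_Units:
  assumes "x \<in> jacobson"
  shows "\<one> \<oplus> x \<in> Units R"
proof -
  have c: "x \<in> carrier R" and "\<one> \<ominus> x \<otimes> (\<ominus> \<one>) \<in> Units R" using assms by (auto simp: jacobson_def)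
  moreover have "\<one> \<ominus> x \<otimes> (\<ominus> \<one>) = \<one> \<oplus> x" using c by (simp add: ring_simprules)
  ultimately show ?thesis by simp
qed

lemma (in ring) jacobson_uminus:
  assumes "x \<in> jacobson"
  shows "\<ominus> x \<in> jacobson"
proof -
  have "x \<otimes> \<ominus> \<one> = \<ominus> x" using assms by (simp add: jacobson_def r_minus)
  then show ?thesis using jacobson_r_closed[OF assms, of "\<ominus> \<one>"] by simp
qed

text \<open>
  If \<open>v\<close> is the inverse of \<open>1 - xr\<close>, then \<open>1 - (x + y)r = (1 - xr)(1 - vyr)\<close>, and \<open>vyr\<close> is in the
  radical because the radical absorbs factors on both sides.
\<close>

lemma (in ring) jacobson_add:
  assumes x: "x \<in> jacobson" and y: "y \<in> jacobson"
  shows "x \<oplus> y \<in> jacobson"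
proof -
  have c: "x \<in> carrier R" "y \<in> carrier R" using x y by (auto simp: jacobson_def)
  have "\<one> \<ominus> (x \<oplus> y) \<otimes> r \<in> Units R" if r: "r \<in> carrier R" for r
  proof -
    have u: "\<one> \<ominus> x \<otimes> r \<in> Units R" using x r by (simp add: jacobson_def)
    then obtain v where v: "v \<in> carrier R" "(\<one> \<ominus> x \<otimes> r) \<otimes> v = \<one>" unfolding Units_def by blast
    have "v \<otimes> (y \<otimes> r) \<in> jacobson"
      using jacobson_l_closed jacobson_r_closed y r v by simp
    then have w: "\<one> \<ominus> v \<otimes> (y \<otimes> r) \<in> Units R"
      using jacobson_uminus one_add_jacobson_Units by (simp add: a_minus_def)
    have "(\<one> \<ominus> x \<otimes> r) \<otimes> (\<one> \<ominus> v \<otimes> (y \<otimes> r)) = (\<one> \<ominus> x \<otimes> r) \<ominus> ((\<one> \<ominus> x \<otimes> r) \<otimes> v) \<otimes> (y \<otimes> r)"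
      using c r v(1) by (simp add: ring_simprules)
    also have "\<dots> = \<one> \<ominus> (x \<oplus> y) \<otimes> r" unfolding v using c r by algebra
    finally show ?thesis using Units_m_closed[OF u w] by simp
  qed
  then show ?thesis using c by (simp add: jacobson_def)
qed

lemma (in ring) jacobson_ideal: "ideal jacobson R"
proof (rule idealI[OF ring_axioms])
  show "subgroup jacobson (add_monoid R)"
  proof (rule add.subgroupI)
    show "jacobson \<subseteq> carrier R" by (auto simp: jacobson_def)
    have "\<zero> \<in> jacobson" by (auto simp: jacobson_def a_minus_def)
    then show "jacobson \<noteq> {}" by auto
  qed (auto simp: jacobson_add jacobson_uminus)
qed (auto simp: jacobson_l_closed jacobson_r_closed)

text \<open>
  Both \<open>1 + j\<close> and \<open>1 + 2j\<close> are units here, so their squares are unipotent.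
\<close>

lemma (in ring) nilpotent_of_jacobson:
  assumes sq: "\<forall>u \<in> Units R. unipotent_elem R (u [^] (2::nat))" and j: "j \<in> jacobson"
  shows "nilpotent_elem R j"
proof -
  have jc: "j \<in> carrier R" using j by (simp add: jacobson_def)
  obtain H where H: "subring H R" "{j} \<subseteq> H" "cring (R\<lparr>carrier := H\<rparr>)"
    and inv: "\<And>u. u \<in> H \<Longrightarrow> u \<in> Units R \<Longrightarrow> inv u \<in> H"
    by (rule commuting_elements_in_subcring[of "{j}"]) (use jc in auto)
  interpret C: cring "R\<lparr>carrier := H\<rparr>" by (rule H(3))
  note sub = subringE[OF H(1)]
  have jH: "j \<in> H" using H(2) by simp
  have unip: "nilpotent_elem (R\<lparr>carrier := H\<rparr>) ((\<one> \<oplus> k) \<otimes> (\<one> \<oplus> k) \<ominus> \<one>)"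
    if k: "k \<in> jacobson" "k \<in> H" for k
  proof -
    have "nilpotent_elem R ((\<one> \<oplus> k) [^] (2::nat) \<ominus> \<one>)"
      using sq one_add_jacobson_Units[OF k(1)] by (simp add: unipotent_elem_def)
    moreover have "(\<one> \<oplus> k) [^] (2::nat) = (\<one> \<oplus> k) \<otimes> (\<one> \<oplus> k)"
      using k(1) by (simp add: numeral_2_eq_2 jacobson_def)
    moreover have "(\<one> \<oplus> k) \<otimes> (\<one> \<oplus> k) \<ominus> \<one> \<in> H"
      using k(2) sub(3,5-7) by (simp add: a_minus_def)
    ultimately show ?thesis by (simp add: nilpotent_subring[OF H(1)])
  qed
  have u: "\<one> \<oplus> j \<in> Units R" "\<one> \<oplus> j \<in> H"
    using one_add_jacobson_Units[OF j] sub(3,7) jH by auto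
  have "nilpotent_elem (R\<lparr>carrier := H\<rparr>) j"
  proof (rule C.nilpotent_of_unipotent_squares)
    show "inv (\<one> \<oplus> j) \<in> carrier (R\<lparr>carrier := H\<rparr>)" using inv[OF u(2,1)] by simp
  qed (use jH u unip[OF j jH] unip[OF jacobson_add[OF j j]] sub(3,6,7)
       in \<open>simp_all add: subring_minus[OF H(1)]\<close>)
  then show ?thesis by (simp add: nilpotent_subring[OF H(1)])
qed

section \<open>Square-zero elements of exchange rings\<close>

text \<open>
  In the corner ring of the idempotent \<open>g\<close>, the element \<open>M\<close> is a root of \<open>X\<^sup>2 = X + 1\<close>. It is therefore
  a unit of the corner for which \<open>M\<^sup>2 - g = M\<close> is again a unit, and a unit is nilpotent only in
  the zero ring. The typical example is the matrix with rows \<open>(1, 1)\<close> and \<open>(1, 0)\<close>.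
\<close>

lemma (in ring) eq_zero_of_corner_golden_ratio:
  assumes M: "M \<in> carrier R" and g: "g \<in> carrier R"
    and MM: "M \<otimes> M = M \<oplus> g" and gM: "g \<otimes> M = M" and Mg: "M \<otimes> g = M"
    and sq: "\<forall>u \<in> Units R. unipotent_elem R (u [^] (2::nat))"
  shows "M = \<zero>"
proof -
  have gg: "g \<otimes> g = g"
  proof -
    have "M \<oplus> g \<otimes> g = g \<otimes> (M \<otimes> M)" using M g gM by (simp add: MM r_distr)
    also have "\<dots> = (g \<otimes> M) \<otimes> M" using M g by (simp add: m_assoc)
    also have "\<dots> = M \<oplus> g" using MM gM by simp
    finally show ?thesis using M g by simp
  qed
  \<comment> \<open>\<open>M - g\<close> is the inverse of \<open>M\<close> in the corner; \<open>U\<close> and \<open>V\<close> extend the two by \<open>1\<close> outside it.\<close>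
  define U V where "U = \<one> \<oplus> (M \<ominus> g)" and "V = \<one> \<oplus> (M \<ominus> (g \<oplus> g))"
  have UV: "U \<in> carrier R" "V \<in> carrier R" using M g by (auto simp: U_def V_def)
  have "U \<otimes> V = \<one> \<oplus> (M \<oplus> M \<ominus> g \<ominus> g \<ominus> g)
      \<oplus> (M \<otimes> M \<oplus> g \<otimes> g \<oplus> g \<otimes> g \<ominus> M \<otimes> g \<ominus> M \<otimes> g \<ominus> g \<otimes> M)"
    and "V \<otimes> U = \<one> \<oplus> (M \<oplus> M \<ominus> g \<ominus> g \<ominus> g)
      \<oplus> (M \<otimes> M \<oplus> g \<otimes> g \<oplus> g \<otimes> g \<ominus> g \<otimes> M \<ominus> g \<otimes> M \<ominus> M \<otimes> g)"
    and "U \<otimes> U = \<one> \<oplus> (M \<oplus> M \<ominus> g \<ominus> g) \<oplus> (M \<otimes> M \<oplus> g \<otimes> g \<ominus> M \<otimes> g \<ominus> g \<otimes> M)"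
    unfolding U_def V_def using M g by (simp_all add: ring_simprules)
  moreover have "\<one> \<oplus> (M \<oplus> M \<ominus> g \<ominus> g \<ominus> g) \<oplus> (M \<oplus> g \<oplus> g \<oplus> g \<ominus> M \<ominus> M \<ominus> M) = \<one>"
    using M g by algebra
  moreover have "\<one> \<oplus> (M \<oplus> M \<ominus> g \<ominus> g) \<oplus> (M \<oplus> g \<oplus> g \<ominus> M \<ominus> M) = \<one> \<oplus> M"
    using M g by algebra
  ultimately have UV1: "U \<otimes> V = \<one>" "V \<otimes> U = \<one>" and UU: "U \<otimes> U = \<one> \<oplus> M"
    unfolding MM gM Mg gg by simp_all
  then have "U \<in> Units R" using UV unfolding Units_def by auto
  moreover have "U [^] (2::nat) \<ominus> \<one> = M"
  proof -
    have "U [^] (2::nat) \<ominus> \<one> = (\<one> \<oplus> M) \<ominus> \<one>" using UU UV by (simp add: numeral_2_eq_2)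
    also have "\<dots> = M" using M by algebra
    finally show ?thesis .
  qed
  ultimately have "nilpotent_elem R M" using sq unfolding unipotent_elem_def by metis
  then obtain n :: nat where n: "M [^] n = \<zero>" unfolding nilpotent_elem_def by blast
  have "M [^] k \<otimes> g = \<zero> \<Longrightarrow> g = \<zero>" for k :: nat
  proof (induction k)
    case 0
    then show ?case using g by simp
  next
    case (Suc k)
    have "M \<otimes> (M \<ominus> g) = M \<otimes> M \<ominus> M \<otimes> g" using M g by algebra
    also have "\<dots> = (M \<oplus> g) \<ominus> M" unfolding MM Mg ..
    also have "\<dots> = g" using M g by algebra
    finally have "M [^] k \<otimes> g = M [^] k \<otimes> (M \<otimes> (M \<ominus> g))" by simp
    also have "\<dots> = M [^] k \<otimes> ((M \<otimes> g) \<otimes> (M \<ominus> g))" unfolding Mg ..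
    also have "\<dots> = (M [^] Suc k \<otimes> g) \<otimes> (M \<ominus> g)" using M g by (simp add: m_assoc)
    also have "\<dots> = \<zero>" using Suc.prems M g by simp
    finally show ?case by (rule Suc.IH)
  qed
  from this[of n] have "g = \<zero>" using n g by simp
  then show ?thesis using gM M by simp
qed

text \<open>
  If \<open>x\<^sup>2 = 0\<close> and \<open>xy\<close> is a nonzero idempotent, then the ring contains a nonzero corner that is a ring of
  two-by-two matrices. After replacing \<open>x\<close> and \<open>y\<close> by \<open>a = xyx\<close> and \<open>b = yxy\<close>, so that \<open>aba = a\<close>
  and \<open>bab = b\<close>, the matrix units are \<open>E\<close>, \<open>a\<close>, \<open>q\<close> and \<open>f = ba\<close>. The corner then contains the
  matrix with rows \<open>(1, 1)\<close> and \<open>(1, 0)\<close>, which is \<open>E + a + q\<close>.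
\<close>

lemma (in ring) idempotent_product_eq_zero:
  assumes xy: "x \<in> carrier R" "y \<in> carrier R" and xx: "x \<otimes> x = \<zero>"
    and idem: "(x \<otimes> y) \<otimes> (x \<otimes> y) = x \<otimes> y"
    and sq: "\<forall>u \<in> Units R. unipotent_elem R (u [^] (2::nat))"
  shows "x \<otimes> y = \<zero>"
proof -
  define a b where "a = x \<otimes> y \<otimes> x" and "b = y \<otimes> x \<otimes> y"
  have c: "a \<in> carrier R" "b \<in> carrier R" using xy by (auto simp: a_def b_def)
  have red: "x \<otimes> (y \<otimes> (x \<otimes> y)) = x \<otimes> y" using idem xy by (simp add: m_assoc)
  have red': "x \<otimes> (y \<otimes> (x \<otimes> (y \<otimes> z))) = x \<otimes> (y \<otimes> z)" if "z \<in> carrier R" for z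
  proof -
    have "x \<otimes> (y \<otimes> (x \<otimes> (y \<otimes> z))) = (x \<otimes> (y \<otimes> (x \<otimes> y))) \<otimes> z"
      using xy that by (simp add: m_assoc)
    then show ?thesis using xy that by (simp add: red m_assoc)
  qed
  have xx': "x \<otimes> (x \<otimes> z) = \<zero>" if "z \<in> carrier R" for z
    using xx xy that by (simp flip: m_assoc)
  have ab: "a \<otimes> b = x \<otimes> y" and aa: "a \<otimes> a = \<zero>" and aba: "a \<otimes> (b \<otimes> a) = a" and bab: "b \<otimes> (a \<otimes> b) = b"
    unfolding a_def b_def using xy by (simp_all add: m_assoc red red' xx xx')
  have aa': "a \<otimes> (a \<otimes> z) = \<zero>" and aba': "a \<otimes> (b \<otimes> (a \<otimes> z)) = a \<otimes> z"
    and bab': "b \<otimes> (a \<otimes> (b \<otimes> z)) = b \<otimes> z" if "z \<in> carrier R" for z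
  proof -
    have "a \<otimes> (a \<otimes> z) = (a \<otimes> a) \<otimes> z" "a \<otimes> (b \<otimes> (a \<otimes> z)) = (a \<otimes> (b \<otimes> a)) \<otimes> z"
      "b \<otimes> (a \<otimes> (b \<otimes> z)) = (b \<otimes> (a \<otimes> b)) \<otimes> z"
      using c that by (simp_all add: m_assoc)
    then show "a \<otimes> (a \<otimes> z) = \<zero>" "a \<otimes> (b \<otimes> (a \<otimes> z)) = a \<otimes> z" "b \<otimes> (a \<otimes> (b \<otimes> z)) = b \<otimes> z"
      using aa aba bab that by simp_all
  qed
  \<comment> \<open>The idempotents \<open>ab\<close> and \<open>ba\<close> satisfy \<open>ba \<cdot> ab = 0\<close>, but \<open>ab \<cdot> ba\<close>
    may differ from zero; passing from \<open>b\<close> to \<open>q\<close> corrects this.\<close>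
  define q where "q = b \<ominus> b \<otimes> (b \<otimes> a)"
  define E f where "E = a \<otimes> q" and "f = b \<otimes> a"
  have c': "q \<in> carrier R" "E \<in> carrier R" "f \<in> carrier R" using c by (auto simp: q_def E_def f_def)
  note rules = m_assoc ring_simprules aa aa' aba aba' bab bab'
  have table: "E \<otimes> E = E" "E \<otimes> a = a" "E \<otimes> q = \<zero>" "E \<otimes> f = \<zero>" "a \<otimes> E = \<zero>" "a \<otimes> q = E" "a \<otimes> f = a"
    "q \<otimes> E = q" "q \<otimes> a = f" "q \<otimes> q = \<zero>" "q \<otimes> f = \<zero>"
    "f \<otimes> E = \<zero>" "f \<otimes> a = \<zero>" "f \<otimes> q = q" "f \<otimes> f = f"
    unfolding E_def f_def q_def using c by (simp_all add: rules)
  have "E \<oplus> a \<oplus> q = \<zero>"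
  proof (rule eq_zero_of_corner_golden_ratio)
    show "(E \<oplus> a \<oplus> q) \<otimes> (E \<oplus> a \<oplus> q) = (E \<oplus> a \<oplus> q) \<oplus> (E \<oplus> f)"
      "(E \<oplus> f) \<otimes> (E \<oplus> a \<oplus> q) = E \<oplus> a \<oplus> q" "(E \<oplus> a \<oplus> q) \<otimes> (E \<oplus> f) = E \<oplus> a \<oplus> q"
      using c c' by (simp_all add: r_distr l_distr table aa a_ac)
  qed (use c c' sq in auto)
  then have "E \<otimes> (E \<oplus> a \<oplus> q) \<otimes> f = \<zero>" using c' by simp
  moreover have "E \<otimes> (E \<oplus> a \<oplus> q) \<otimes> f = a"
    using c c' by (simp add: r_distr l_distr table)
  ultimately show ?thesis using ab c by simp
qed

lemma exchange_ringI:
  assumes "\<And>a. a \<in> carrier R \<Longrightarrow> \<exists>e r s. idempotent_elem R e \<and> r \<in> carrier R \<and> s \<in> carrier R \<and>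
    e = a \<otimes>\<^bsub>R\<^esub> r \<and> \<one>\<^bsub>R\<^esub> \<ominus>\<^bsub>R\<^esub> e = (\<one>\<^bsub>R\<^esub> \<ominus>\<^bsub>R\<^esub> a) \<otimes>\<^bsub>R\<^esub> s"
  shows "exchange_ring R"
  unfolding exchange_ring_def l_coset_def
proof
  fix a assume "a \<in> carrier R"
  from assms[OF this] show "\<exists>e. idempotent_elem R e \<and> e \<in> (\<Union>h\<in>carrier R. {a \<otimes>\<^bsub>R\<^esub> h}) \<and>
    \<one>\<^bsub>R\<^esub> \<ominus>\<^bsub>R\<^esub> e \<in> (\<Union>h\<in>carrier R. {(\<one>\<^bsub>R\<^esub> \<ominus>\<^bsub>R\<^esub> a) \<otimes>\<^bsub>R\<^esub> h})"
    by blast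
qed

lemma exchange_ringD:
  assumes "exchange_ring R" "a \<in> carrier R"
  obtains e r s where "e \<in> carrier R" "e \<otimes>\<^bsub>R\<^esub> e = e" "r \<in> carrier R" "s \<in> carrier R"
    "e = a \<otimes>\<^bsub>R\<^esub> r" "\<one>\<^bsub>R\<^esub> \<ominus>\<^bsub>R\<^esub> e = (\<one>\<^bsub>R\<^esub> \<ominus>\<^bsub>R\<^esub> a) \<otimes>\<^bsub>R\<^esub> s"
  using assms unfolding exchange_ring_def idempotent_elem_def l_coset_def by blast

text \<open>
  Applied to \<open>xr\<close>, the exchange property yields an idempotent in \<open>xR\<close>, which must vanish. Hence every
  \<open>1 - xr\<close> has a right inverse \<open>t\<close>. As \<open>t = 1 - x(-rt)\<close> has the same form, it has a right inverse too,
  and both elements are units.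
\<close>

lemma (in ring) square_zero_in_jacobson:
  assumes ex: "exchange_ring R"
    and sq: "\<forall>u \<in> Units R. unipotent_elem R (u [^] (2::nat))"
    and x: "x \<in> carrier R" "x \<otimes> x = \<zero>"
  shows "x \<in> jacobson"
proof -
  have right_inverse: "\<exists>t \<in> carrier R. (\<one> \<ominus> x \<otimes> r) \<otimes> t = \<one>" if r: "r \<in> carrier R" for r
  proof -
    obtain e s t where e: "e \<in> carrier R" "e \<otimes> e = e" and st: "s \<in> carrier R" "t \<in> carrier R"
      and es: "e = (x \<otimes> r) \<otimes> s" and et: "\<one> \<ominus> e = (\<one> \<ominus> x \<otimes> r) \<otimes> t"
      by (rule exchange_ringD[OF ex m_closed[OF x(1) r]])
    have exy: "e = x \<otimes> (r \<otimes> s)" using es x r st by (simp add: m_assoc)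
    have "x \<otimes> (r \<otimes> s) = \<zero>"
      by (rule idempotent_product_eq_zero[OF x(1) _ x(2)])
         (use r st sq e(2) in \<open>simp_all flip: exy\<close>)
    then have "(\<one> \<ominus> x \<otimes> r) \<otimes> t = \<one>" using et exy by (simp add: a_minus_def)
    then show ?thesis using st by blast
  qed
  have "\<one> \<ominus> x \<otimes> r \<in> Units R" if r: "r \<in> carrier R" for r
  proof -
    obtain t where t: "t \<in> carrier R" "(\<one> \<ominus> x \<otimes> r) \<otimes> t = \<one>" using right_inverse r by blast
    have "t = (t \<ominus> x \<otimes> (r \<otimes> t)) \<oplus> x \<otimes> (r \<otimes> t)" using x(1) r t(1) by algebra
    also have "t \<ominus> x \<otimes> (r \<otimes> t) = (\<one> \<ominus> x \<otimes> r) \<otimes> t" using x(1) r t(1) by algebra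
    also have "\<dots> \<oplus> x \<otimes> (r \<otimes> t) = \<one> \<ominus> x \<otimes> (\<ominus> (r \<otimes> t))"
      unfolding t(2) using x(1) r t(1) by algebra
    finally have teq: "t = \<one> \<ominus> x \<otimes> (\<ominus> (r \<otimes> t))" .
    obtain z where z: "z \<in> carrier R" "t \<otimes> z = \<one>"
      using right_inverse[of "\<ominus> (r \<otimes> t)"] teq r t(1) by auto
    have "t \<in> Units R"
      by (rule Units_of_one_sided[of t "\<one> \<ominus> x \<otimes> r" z]) (use x r t z in auto)
    moreover have "z = \<one> \<ominus> x \<otimes> r"
      by (rule inv_unique[of "\<one> \<ominus> x \<otimes> r" t z, symmetric]) (use x r t z in auto)
    ultimately show ?thesis using t z x r unfolding Units_def by auto
  qed
  then show ?thesis using x by (simp add: jacobson_def)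
qed

section \<open>Reduced exchange rings\<close>

text \<open>
  The elements \<open>er(1 - e)\<close> and \<open>(1 - e)re\<close> have square zero.
\<close>

lemma (in ring) idempotent_central_of_reduced:
  assumes red: "\<forall>x \<in> carrier R. x \<otimes> x = \<zero> \<longrightarrow> x = \<zero>"
    and e: "e \<in> carrier R" "e \<otimes> e = e" and r: "r \<in> carrier R"
  shows "e \<otimes> r = r \<otimes> e"
proof -
  have e': "e \<otimes> (e \<otimes> z) = e \<otimes> z" if "z \<in> carrier R" for z
    using e that by (simp flip: m_assoc)
  have "e \<otimes> r \<ominus> e \<otimes> (r \<otimes> e) = \<zero>"
    by (rule red[rule_format]) (use e r e' in \<open>simp_all add: ring_simprules\<close>)
  moreover have "r \<otimes> e \<ominus> e \<otimes> (r \<otimes> e) = \<zero>"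
    by (rule red[rule_format]) (use e r e' in \<open>simp_all add: ring_simprules\<close>)
  ultimately show ?thesis using e r by (metis m_closed r_right_minus_eq)
qed

lemma (in ring) nilpotent_zero_of_reduced:
  assumes red: "\<forall>x \<in> carrier R. x \<otimes> x = \<zero> \<longrightarrow> x = \<zero>"
    and "nilpotent_elem R x"
  shows "x = \<zero>"
proof -
  obtain n :: nat where n: "x [^] n = \<zero>" and x: "x \<in> carrier R"
    using assms(2) unfolding nilpotent_elem_def by blast
  have "x [^] k = \<zero> \<Longrightarrow> x = \<zero>" for k :: nat
  proof (induction k rule: less_induct)
    case (less k)
    show ?case
    proof (cases "k \<le> 1")
      case True
      then have "k = 0 \<or> k = 1" by auto
      then show ?thesis using less.prems x by (metis One_nat_def l_null nat_pow_0 nat_pow_eone l_one)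
    next
      case False
      have "x [^] (k - 1) \<otimes> x [^] (k - 1) = x [^] k \<otimes> x [^] (k - 2)"
        using False x by (simp add: nat_pow_mult numeral_2_eq_2)
      then have "x [^] (k - 1) \<otimes> x [^] (k - 1) = \<zero>" using less.prems x by simp
      then have "x [^] (k - 1) = \<zero>" using red x by blast
      then show ?thesis using less.IH[of "k - 1"] False by simp
    qed
  qed
  then show ?thesis using n by blast
qed

text \<open>
  On the factor \<open>eR\<close> the element \<open>a\<close> has the right inverse \<open>r\<close>. Extending by the identity on the other
  factor gives a right invertible \<open>u\<close>, and reduced rings are Dedekind finite, so \<open>u\<close> is a unit. In a
  reduced ring a unipotent element is \<open>1\<close>; thus \<open>u\<^sup>2 = 1\<close>, and multiplying by \<open>e\<close> gives the claim.
\<close>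

lemma (in ring) square_on_right_ideal_of_reduced:
  assumes red: "\<forall>x \<in> carrier R. x \<otimes> x = \<zero> \<longrightarrow> x = \<zero>"
    and sq: "\<forall>u \<in> Units R. unipotent_elem R (u [^] (2::nat))"
    and e: "e \<in> carrier R" "e \<otimes> e = e" and a: "a \<in> carrier R" and r: "r \<in> carrier R" and er: "e = a \<otimes> r"
  shows "a \<otimes> a \<otimes> e = e"
proof -
  have central: "e \<otimes> z = z \<otimes> e" if "z \<in> carrier R" for z
    using idempotent_central_of_reduced red e that by blast
  have e': "e \<otimes> (e \<otimes> z) = e \<otimes> z" if "z \<in> carrier R" for z
    using e that by (simp flip: m_assoc)
  have swap: "e \<otimes> a = a \<otimes> e" "e \<otimes> r = r \<otimes> e" using central a r by auto
  have swap': "e \<otimes> (a \<otimes> z) = a \<otimes> (e \<otimes> z)" "e \<otimes> (r \<otimes> z) = r \<otimes> (e \<otimes> z)" "a \<otimes> (r \<otimes> z) = e \<otimes> z"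
    if "z \<in> carrier R" for z
    using swap a r e that er by (simp_all flip: m_assoc)
  define u v where "u = a \<otimes> e \<oplus> (\<one> \<ominus> e)" and "v = r \<otimes> e \<oplus> (\<one> \<ominus> e)"
  have uv: "u \<in> carrier R" "v \<in> carrier R" using a e r by (auto simp: u_def v_def)
  have uv1: "u \<otimes> v = \<one>"
    unfolding u_def v_def using a e(1) r by (simp add: ring_simprules e(2) e' swap swap')
  have uv1': "u \<otimes> (v \<otimes> z) = z" if "z \<in> carrier R" for z
    using uv uv1 that by (simp flip: m_assoc)
  \<comment> \<open>The central idempotent \<open>h\<close> measures the failure of \<open>v\<close> to be a left inverse.\<close>
  define h where "h = \<one> \<ominus> v \<otimes> u"
  have h: "h \<in> carrier R" using uv by (simp add: h_def)
  have "h \<otimes> h = h" unfolding h_def using uv by (simp add: ring_simprules uv1')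
  then have "h \<otimes> u = u \<otimes> h"
    using idempotent_central_of_reduced[OF red h _ uv(1)] by simp
  also have "\<dots> = \<zero>" unfolding h_def using uv by (simp add: ring_simprules uv1')
  finally have "(h \<otimes> u) \<otimes> v = \<zero>" using uv by simp
  then have "h = \<zero>" using h uv uv1 by (simp add: m_assoc)
  then have "v \<otimes> u = \<one>" unfolding h_def using uv by (simp add: r_right_minus_eq)
  then have "u \<in> Units R" using uv uv1 unfolding Units_def by auto
  then have "nilpotent_elem R (u [^] (2::nat) \<ominus> \<one>)"
    using sq unfolding unipotent_elem_def by blast
  then have "u [^] (2::nat) \<ominus> \<one> = \<zero>" by (rule nilpotent_zero_of_reduced[OF red])
  then have "u \<otimes> u = \<one>" using uv by (simp add: numeral_2_eq_2 r_right_minus_eq)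
  then have "(u \<otimes> u) \<otimes> e = e" using e by simp
  moreover have "(u \<otimes> u) \<otimes> e = a \<otimes> a \<otimes> e"
    unfolding u_def using a e(1) by (simp add: ring_simprules e(2) e' swap swap')
  ultimately show ?thesis by simp
qed

text \<open>
  The exchange property splits the ring into a factor with \<open>b\<^sup>2 = 1\<close> and a factor with
  \<open>(1 - b)\<^sup>2 = 1\<close>. For \<open>b = 3\<close> these equations read \<open>8 = 0\<close> and \<open>3 = 0\<close>; in a reduced ring they
  give \<open>2 = 0\<close> and \<open>3 = 0\<close>, and therefore \<open>6 = 0\<close> in the whole ring. For general \<open>b = a\<close>, the
  equation \<open>a\<^sup>3 = a\<close> is clear on the first factor. On the second one \<open>a\<^sup>2 = 2a\<close>, so that
  \<open>(3a)\<^sup>2 = 18a = 0\<close>, hence \<open>3a = 0\<close> and \<open>a\<^sup>3 = 4a = a\<close>.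
\<close>

lemma (in ring) cube_eq_self_of_reduced_exchange:
  assumes red: "\<forall>x \<in> carrier R. x \<otimes> x = \<zero> \<longrightarrow> x = \<zero>"
    and ex: "exchange_ring R"
    and sq: "\<forall>u \<in> Units R. unipotent_elem R (u [^] (2::nat))"
    and a: "a \<in> carrier R"
  shows "a \<otimes> a \<otimes> a = a"
proof -
  have pieces: "\<exists>e \<in> carrier R. e \<otimes> e = e \<and> b \<otimes> b \<otimes> e = e \<and>
      (\<one> \<ominus> b) \<otimes> (\<one> \<ominus> b) \<otimes> (\<one> \<ominus> e) = \<one> \<ominus> e" if b: "b \<in> carrier R" for b
  proof -
    obtain e r s where e: "e \<in> carrier R" "e \<otimes> e = e" and rs: "r \<in> carrier R" "s \<in> carrier R"
      and er: "e = b \<otimes> r" and es: "\<one> \<ominus> e = (\<one> \<ominus> b) \<otimes> s"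
      by (rule exchange_ringD[OF ex b])
    have d: "(\<one> \<ominus> e) \<otimes> (\<one> \<ominus> e) = \<one> \<ominus> e"
      using e by (simp add: ring_simprules)
    have "b \<otimes> b \<otimes> e = e"
      by (rule square_on_right_ideal_of_reduced[OF red sq e b rs(1) er])
    moreover have "(\<one> \<ominus> b) \<otimes> (\<one> \<ominus> b) \<otimes> (\<one> \<ominus> e) = \<one> \<ominus> e"
      by (rule square_on_right_ideal_of_reduced[OF red sq _ d _ rs(2) es]) (use b e in simp_all)
    ultimately show ?thesis using e by blast
  qed
  have six: "z \<oplus> z \<oplus> z \<oplus> z \<oplus> z \<oplus> z = \<zero>" if z: "z \<in> carrier R" for z
  proof -
    define t where "t = \<one> \<oplus> \<one> \<oplus> \<one>"
    have t: "t \<in> carrier R" by (simp add: t_def)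
    obtain e where e: "e \<in> carrier R" "e \<otimes> e = e" "t \<otimes> t \<otimes> e = e"
      and te: "(\<one> \<ominus> t) \<otimes> (\<one> \<ominus> t) \<otimes> (\<one> \<ominus> e) = \<one> \<ominus> e"
      using pieces[OF t] by blast
    have "((e \<oplus> e) \<otimes> (e \<oplus> e)) \<otimes> (e \<oplus> e) = t \<otimes> t \<otimes> e \<ominus> e"
      unfolding t_def using e(1,2) by algebra
    also have "\<dots> = \<zero>" using e by (simp add: r_right_minus_eq)
    finally have "(e \<oplus> e) [^] (3::nat) = \<zero>" using e by (simp add: numeral_3_eq_3)
    then have "nilpotent_elem R (e \<oplus> e)"
      using e(1) unfolding nilpotent_elem_def by (auto intro!: exI[of _ 3])
    then have two: "e \<oplus> e = \<zero>" by (rule nilpotent_zero_of_reduced[OF red])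
    define d where "d = \<one> \<ominus> e"
    have d: "d \<in> carrier R" using e by (simp add: d_def)
    have "d \<oplus> d \<oplus> d = (\<one> \<ominus> t) \<otimes> (\<one> \<ominus> t) \<otimes> d \<ominus> d"
      unfolding t_def using d by algebra
    also have "\<dots> = \<zero>" using te d by (simp add: r_right_minus_eq flip: d_def)
    finally have three: "d \<oplus> d \<oplus> d = \<zero>" .
    have "\<one> = e \<oplus> d" unfolding d_def using e(1) by algebra
    then have sum: "(e \<oplus> d) \<otimes> z = z" using l_one[OF z] by simp
    have "(e \<oplus> d) \<otimes> z \<oplus> (e \<oplus> d) \<otimes> z \<oplus> (e \<oplus> d) \<otimes> z \<oplus> (e \<oplus> d) \<otimes> z \<oplus> (e \<oplus> d) \<otimes> z \<oplus> (e \<oplus> d) \<otimes> z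
        = ((e \<oplus> e) \<oplus> (e \<oplus> e) \<oplus> (e \<oplus> e) \<oplus> (d \<oplus> d \<oplus> d) \<oplus> (d \<oplus> d \<oplus> d)) \<otimes> z"
      using e(1) d z by (simp add: l_distr a_ac)
    also have "\<dots> = \<zero>" unfolding two three using z by simp
    finally show ?thesis unfolding sum .
  qed
  obtain e where e: "e \<in> carrier R" "e \<otimes> e = e" "a \<otimes> a \<otimes> e = e"
    and ae: "(\<one> \<ominus> a) \<otimes> (\<one> \<ominus> a) \<otimes> (\<one> \<ominus> e) = \<one> \<ominus> e"
    using pieces[OF a] by blast
  define d where "d = \<one> \<ominus> e"
  have d: "d \<in> carrier R" using e by (simp add: d_def)
  have dd: "d \<otimes> d = d" unfolding d_def using e by (simp add: ring_simprules)
  have da: "d \<otimes> a = a \<otimes> d" by (rule idempotent_central_of_reduced[OF red d dd a])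
  define w where "w = a \<otimes> d"
  have w: "w \<in> carrier R" using a d by (simp add: w_def)
  have "a \<otimes> w = ((\<one> \<ominus> a) \<otimes> (\<one> \<ominus> a) \<otimes> d \<ominus> d) \<oplus> (w \<oplus> w)"
    unfolding w_def using a d by algebra
  also have "(\<one> \<ominus> a) \<otimes> (\<one> \<ominus> a) \<otimes> d \<ominus> d = \<zero>"
    using ae d by (simp add: r_right_minus_eq flip: d_def)
  finally have aw: "a \<otimes> w = w \<oplus> w" using w by simp
  have dw: "d \<otimes> w = w"
    unfolding w_def using a d by (simp add: da dd flip: m_assoc) (simp add: dd m_assoc)
  have "w \<otimes> w = a \<otimes> (d \<otimes> w)" using a d w by (simp add: w_def m_assoc)
  also have "\<dots> = w \<oplus> w" unfolding dw by (rule aw)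
  finally have ww: "w \<otimes> w = w \<oplus> w" .
  have "(w \<oplus> w \<oplus> w) \<otimes> (w \<oplus> w \<oplus> w) = (w \<oplus> w \<oplus> w \<oplus> w \<oplus> w \<oplus> w) \<oplus>
     (w \<oplus> w \<oplus> w \<oplus> w \<oplus> w \<oplus> w) \<oplus> (w \<oplus> w \<oplus> w \<oplus> w \<oplus> w \<oplus> w)"
    using w by (simp add: ring_simprules ww)
  also have "\<dots> = \<zero>" unfolding six[OF w] by simp
  finally have "(w \<oplus> w \<oplus> w) \<otimes> (w \<oplus> w \<oplus> w) = \<zero>" .
  then have www: "w \<oplus> w \<oplus> w = \<zero>" by (rule red[rule_format, rotated]) (use w in simp)
  have aaw: "a \<otimes> (a \<otimes> w) = (w \<oplus> w \<oplus> w) \<oplus> w"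
    unfolding aw using a w by (simp add: r_distr aw a_assoc)
  have "e \<oplus> d = \<one>" unfolding d_def using e(1) by algebra
  then have split: "a = a \<otimes> e \<oplus> w" unfolding w_def using a d e(1) by (simp flip: r_distr)
  then have "a \<otimes> a \<otimes> a = a \<otimes> a \<otimes> (a \<otimes> e \<oplus> w)" by (rule arg_cong)
  also have "\<dots> = a \<otimes> (a \<otimes> a \<otimes> e) \<oplus> a \<otimes> (a \<otimes> w)" using a e(1) w by algebra
  also have "\<dots> = a \<otimes> e \<oplus> w" unfolding e(3) aaw www using w by simp
  also have "\<dots> = a" by (rule split[symmetric])
  finally show ?thesis .
qed

section \<open>Passage to the quotient by the radical\<close>

text \<open>
  If \<open>h u\<close> has the inverse \<open>h v\<close>, then \<open>uv\<close> and \<open>vu\<close> lie in \<open>1 + J\<close>, where \<open>J\<close> is the Jacobson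
  radical, and are therefore units.
\<close>

lemma (in ring_hom_ring) Units_lift:
  assumes surj: "h ` carrier R = carrier S" and ker: "\<And>x. x \<in> carrier R \<Longrightarrow> h x = \<zero>\<^bsub>S\<^esub> \<Longrightarrow> x \<in> R.jacobson"
    and u: "u \<in> carrier R" "h u \<in> Units S"
  shows "u \<in> Units R"
proof -
  obtain v' where v': "v' \<in> carrier S" "v' \<otimes>\<^bsub>S\<^esub> h u = \<one>\<^bsub>S\<^esub>" "h u \<otimes>\<^bsub>S\<^esub> v' = \<one>\<^bsub>S\<^esub>"
    using u(2) unfolding Units_def by blast
  have "v' \<in> h ` carrier R" using v'(1) surj by simp
  then obtain v where v: "v \<in> carrier R" "h v = v'" by auto
  have *: "z \<in> Units R" if "z \<in> carrier R" "h z = \<one>\<^bsub>S\<^esub>" for z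
  proof -
    have "h (z \<ominus> \<one>) = \<zero>\<^bsub>S\<^esub>" using that by (simp add: a_minus_def S.r_neg)
    then have "\<one> \<oplus> (z \<ominus> \<one>) \<in> Units R" using ker R.one_add_jacobson_Units that by simp
    moreover have "\<one> \<oplus> (z \<ominus> \<one>) = z" using that by algebra
    ultimately show ?thesis by simp
  qed
  have "u \<otimes> v \<in> Units R" "v \<otimes> u \<in> Units R" using * u v v' by auto
  then obtain p q where "p \<in> carrier R" "q \<in> carrier R"
    "u \<otimes> v \<otimes> p = \<one>" "q \<otimes> (v \<otimes> u) = \<one>"
    unfolding Units_def by blast
  then show ?thesis
    using R.Units_of_one_sided[of u "q \<otimes> v" "v \<otimes> p"] u(1) v(1) by (simp add: R.m_assoc)
qed
lemma (in ring_hom_ring) exchange_image: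
  assumes surj: "h ` carrier R = carrier S" and ex: "exchange_ring R"
  shows "exchange_ring S"
proof (rule exchange_ringI)
  fix b assume "b \<in> carrier S"
  then obtain a where a: "a \<in> carrier R" and b: "b = h a" using surj by (metis imageE)
  obtain e r s where e: "e \<in> carrier R" "e \<otimes> e = e" and rs: "r \<in> carrier R" "s \<in> carrier R"
    and er: "e = a \<otimes> r" and es: "\<one> \<ominus> e = (\<one> \<ominus> a) \<otimes> s"
    by (rule exchange_ringD[OF ex a])
  have "h e \<otimes>\<^bsub>S\<^esub> h e = h e" using e by (metis hom_mult)
  moreover have "h e = b \<otimes>\<^bsub>S\<^esub> h r" using er a rs b by simp
  moreover have "\<one>\<^bsub>S\<^esub> \<ominus>\<^bsub>S\<^esub> h e = (\<one>\<^bsub>S\<^esub> \<ominus>\<^bsub>S\<^esub> b) \<otimes>\<^bsub>S\<^esub> h s"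
  proof -
    have "h (\<one> \<ominus> e) = h ((\<one> \<ominus> a) \<otimes> s)" using es by simp
    then show ?thesis using e a rs b by (simp add: a_minus_def)
  qed
  ultimately show "\<exists>f p q. idempotent_elem S f \<and> p \<in> carrier S \<and> q \<in> carrier S \<and>
      f = b \<otimes>\<^bsub>S\<^esub> p \<and> \<one>\<^bsub>S\<^esub> \<ominus>\<^bsub>S\<^esub> f = (\<one>\<^bsub>S\<^esub> \<ominus>\<^bsub>S\<^esub> b) \<otimes>\<^bsub>S\<^esub> q"
    using hom_closed e(1) rs unfolding idempotent_elem_def by blast
qed

lemma (in ring_hom_ring) unipotent_squares_image:
  assumes surj: "h ` carrier R = carrier S"
    and ker: "\<And>x. x \<in> carrier R \<Longrightarrow> h x = \<zero>\<^bsub>S\<^esub> \<Longrightarrow> x \<in> R.jacobson"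
    and sq: "\<forall>u \<in> Units R. unipotent_elem R (u [^] (2::nat))"
  shows "\<forall>u \<in> Units S. unipotent_elem S (u [^]\<^bsub>S\<^esub> (2::nat))"
proof
  fix v assume v: "v \<in> Units S"
  then obtain u where u: "u \<in> carrier R" and uv: "v = h u" using surj by (metis S.Units_closed imageE)
  have "u \<in> Units R" using Units_lift[OF surj ker u] v uv by simp
  then have nil: "nilpotent_elem R (u [^] (2::nat) \<ominus> \<one>)" using sq by (simp add: unipotent_elem_def)
  have pow: "h (x [^] n) = h x [^]\<^bsub>S\<^esub> n" if "x \<in> carrier R" for x and n :: nat
    using that by (induction n) simp_all
  obtain n :: nat where n: "n > 0" "(u [^] (2::nat) \<ominus> \<one>) [^] n = \<zero>"
    using nil unfolding nilpotent_elem_def by blast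
  have "h ((u [^] (2::nat) \<ominus> \<one>) [^] n) = (v [^]\<^bsub>S\<^esub> (2::nat) \<ominus>\<^bsub>S\<^esub> \<one>\<^bsub>S\<^esub>) [^]\<^bsub>S\<^esub> n"
    using u uv by (simp add: pow a_minus_def)
  then have "(v [^]\<^bsub>S\<^esub> (2::nat) \<ominus>\<^bsub>S\<^esub> \<one>\<^bsub>S\<^esub>) [^]\<^bsub>S\<^esub> n = \<zero>\<^bsub>S\<^esub>" using n(2) by simp
  then show "unipotent_elem S (v [^]\<^bsub>S\<^esub> (2::nat))"
    using n(1) u uv unfolding unipotent_elem_def nilpotent_elem_def by auto
qed

text \<open>
  A square-zero element of the quotient lies in the radical of the quotient, and that radical vanishes
  because units lift.
\<close>

lemma (in ring_hom_ring) reduced_of_jacobson_kernel: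
  assumes surj: "h ` carrier R = carrier S"
    and ker: "\<And>x. x \<in> carrier R \<Longrightarrow> h x = \<zero>\<^bsub>S\<^esub> \<longleftrightarrow> x \<in> R.jacobson"
    and ex: "exchange_ring R"
    and sq: "\<forall>u \<in> Units R. unipotent_elem R (u [^] (2::nat))"
  shows "\<forall>x \<in> carrier S. x \<otimes>\<^bsub>S\<^esub> x = \<zero>\<^bsub>S\<^esub> \<longrightarrow> x = \<zero>\<^bsub>S\<^esub>"
proof (intro ballI impI)
  have ker': "\<And>x. x \<in> carrier R \<Longrightarrow> h x = \<zero>\<^bsub>S\<^esub> \<Longrightarrow> x \<in> R.jacobson" using ker by blast
  fix y assume y: "y \<in> carrier S" "y \<otimes>\<^bsub>S\<^esub> y = \<zero>\<^bsub>S\<^esub>"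
  then obtain x where x: "x \<in> carrier R" and yx: "y = h x" using surj by (metis imageE)
  have "y \<in> S.jacobson"
    using S.square_zero_in_jacobson[OF exchange_image[OF surj ex] unipotent_squares_image[OF surj ker' sq] y] .
  then have "\<one> \<ominus> x \<otimes> r \<in> Units R" if "r \<in> carrier R" for r
    using that x Units_lift[OF surj ker', of "\<one> \<ominus> x \<otimes> r"]
    by (simp add: yx S.jacobson_def a_minus_def)
  then show "y = \<zero>\<^bsub>S\<^esub>" using x ker by (simp add: yx R.jacobson_def)
qed

text \<open>
  The cube identity holds modulo the Jacobson radical, and the radical is nil.
\<close>

lemma (in ring) cube_sub_self_nilpotent:
  assumes ex: "exchange_ring R"
    and sq: "\<forall>u \<in> Units R. unipotent_elem R (u [^] (2::nat))"
    and a: "a \<in> carrier R"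
  shows "nilpotent_elem R (a \<otimes> a \<otimes> a \<ominus> a)"
proof -
  interpret J: ideal jacobson R by (rule jacobson_ideal)
  interpret h: ring_hom_ring R "R Quot jacobson" "(+>) jacobson" by (rule J.rcos_ring_hom_ring)
  have surj: "(+>) jacobson ` carrier R = carrier (R Quot jacobson)"
    unfolding FactRing_def A_RCOSETS_def' by auto
  have ker: "jacobson +> x = \<zero>\<^bsub>R Quot jacobson\<^esub> \<longleftrightarrow> x \<in> jacobson" if "x \<in> carrier R" for x
  proof -
    have "jacobson +> x = jacobson \<longleftrightarrow> x \<in> jacobson"
    proof
      assume "jacobson +> x = jacobson"
      then show "x \<in> jacobson" using J.a_rcos_self[OF that] by (simp only:)
    qed (rule J.a_rcos_const)
    then show ?thesis unfolding FactRing_def by (simp only: ring_record_simps)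
  qed
  have ker': "\<And>x. x \<in> carrier R \<Longrightarrow> jacobson +> x = \<zero>\<^bsub>R Quot jacobson\<^esub> \<Longrightarrow> x \<in> jacobson"
    by (simp only: ker)
  note red = h.reduced_of_jacobson_kernel[OF surj ker ex sq]
  note ex' = h.exchange_image[OF surj ex]
  note sq' = h.unipotent_squares_image[OF surj ker' sq]
  have cube: "(jacobson +> a) \<otimes>\<^bsub>R Quot jacobson\<^esub> (jacobson +> a) \<otimes>\<^bsub>R Quot jacobson\<^esub> (jacobson +> a)
      = jacobson +> a"
    by (rule h.S.cube_eq_self_of_reduced_exchange[OF red ex' sq' h.hom_closed[OF a]])
  have "jacobson +> (a \<otimes> a \<otimes> a \<ominus> a) = ((jacobson +> a) \<otimes>\<^bsub>R Quot jacobson\<^esub> (jacobson +> a)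
      \<otimes>\<^bsub>R Quot jacobson\<^esub> (jacobson +> a)) \<ominus>\<^bsub>R Quot jacobson\<^esub> (jacobson +> a)"
    using a by (simp only: a_minus_def h.hom_mult h.hom_add h.hom_a_inv m_closed a_inv_closed)
  also have "\<dots> = \<zero>\<^bsub>R Quot jacobson\<^esub>"
    unfolding cube a_minus_def by (rule h.S.r_neg[OF h.hom_closed[OF a]])
  finally have "jacobson +> (a \<otimes> a \<otimes> a \<ominus> a) = \<zero>\<^bsub>R Quot jacobson\<^esub>" .
  then have "a \<otimes> a \<otimes> a \<ominus> a \<in> jacobson"
    by (rule ker'[rotated]) (intro minus_closed m_closed a)
  then show ?thesis by (rule nilpotent_of_jacobson[OF sq])
qed

section \<open>Strongly 2-nil-clean rings and cubes\<close>

text \<open>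
  Decompose the element \<open>-1\<close>.
\<close>

lemma (in ring) strongly_2_nil_clean_six_nilpotent:
  assumes "strongly_2_nil_clean R"
  shows "nilpotent_elem R ((\<one> \<oplus> \<one>) \<otimes> (\<one> \<oplus> \<one> \<oplus> \<one>))"
proof -
  obtain e f w where efw: "idempotent_elem R e" "idempotent_elem R f" "nilpotent_elem R w"
    and comm: "e \<otimes> f = f \<otimes> e" "e \<otimes> w = w \<otimes> e" "f \<otimes> w = w \<otimes> f" and sum: "\<ominus> \<one> = e \<oplus> f \<oplus> w"
    using assms unfolding strongly_2_nil_clean_def by (meson a_inv_closed one_closed)
  obtain H where H: "subring H R" "{e, f, w} \<subseteq> H" "cring (R\<lparr>carrier := H\<rparr>)"
    by (rule commuting_elements_in_subcring[of "{e, f, w}"])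
       (use efw comm in \<open>auto simp: idempotent_elem_def nilpotent_elem_def\<close>)
  interpret C: cring "R\<lparr>carrier := H\<rparr>" by (rule H(3))
  have "nilpotent_elem (R\<lparr>carrier := H\<rparr>) ((\<one> \<oplus> \<one>) \<otimes> (\<one> \<oplus> \<one> \<oplus> \<one>))"
    using C.six_nilpotent[of e f w] efw sum H(2) subringE(3)[OF H(1)]
    by (simp add: nilpotent_subring[OF H(1)] idempotent_subring[OF H(1)] subring_minus[OF H(1)])
  then show ?thesis by (simp add: nilpotent_subring[OF H(1)])
qed

lemma (in ring) strongly_2_nil_clean_cube:
  assumes clean: "strongly_2_nil_clean R" and a: "a \<in> carrier R"
  shows "nilpotent_elem R (a \<otimes> a \<otimes> a \<ominus> a)"
proof -
  obtain e f w where efw: "idempotent_elem R e" "idempotent_elem R f" "nilpotent_elem R w"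
    and comm: "e \<otimes> f = f \<otimes> e" "e \<otimes> w = w \<otimes> e" "f \<otimes> w = w \<otimes> f" and sum: "a = e \<oplus> f \<oplus> w"
    using assms unfolding strongly_2_nil_clean_def by meson
  obtain H where H: "subring H R" "{e, f, w} \<subseteq> H" "cring (R\<lparr>carrier := H\<rparr>)"
    by (rule commuting_elements_in_subcring[of "{e, f, w}"])
       (use efw comm in \<open>auto simp: idempotent_elem_def nilpotent_elem_def\<close>)
  interpret C: cring "R\<lparr>carrier := H\<rparr>" by (rule H(3))
  note sub = subringE[OF H(1)]
  have six: "(\<one> \<oplus> \<one>) \<otimes> (\<one> \<oplus> \<one> \<oplus> \<one>) \<in> H" and aH: "a \<in> H"
    using sub(3,6,7) H(2) sum by auto
  have "nilpotent_elem (R\<lparr>carrier := H\<rparr>) (a \<otimes> a \<otimes> a \<ominus> a)"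
    using C.two_idempotents_cube[of e f w a] efw sum H(2) aH six sub(6)
      strongly_2_nil_clean_six_nilpotent[OF clean]
    by (simp add: nilpotent_subring[OF H(1)] idempotent_subring[OF H(1)] subring_minus[OF H(1)])
  then show ?thesis by (simp add: nilpotent_subring[OF H(1)])
qed

lemma (in ring) exchange_ring_of_cubes:
  assumes "\<And>a. a \<in> carrier R \<Longrightarrow> nilpotent_elem R (a \<otimes> a \<otimes> a \<ominus> a)"
  shows "exchange_ring R"
proof (rule exchange_ringI)
  fix a assume a: "a \<in> carrier R"
  obtain H where H: "subring H R" "{a} \<subseteq> H" "cring (R\<lparr>carrier := H\<rparr>)"
    by (rule commuting_elements_in_subcring[of "{a}"]) (use a in auto)
  interpret C: cring "R\<lparr>carrier := H\<rparr>" by (rule H(3))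
  note sub = subringE[OF H(1)]
  have aH: "a \<in> carrier (R\<lparr>carrier := H\<rparr>)" using H(2) by simp
  have mH: "x \<ominus> y \<in> H" if "x \<in> H" "y \<in> H" for x y using that sub(5,7) by (simp add: a_minus_def)
  have nil: "nilpotent_elem (R\<lparr>carrier := H\<rparr>) (a \<otimes>\<^bsub>R\<lparr>carrier := H\<rparr>\<^esub> a \<otimes>\<^bsub>R\<lparr>carrier := H\<rparr>\<^esub> a \<ominus>\<^bsub>R\<lparr>carrier := H\<rparr>\<^esub> a)"
    using assms[OF a] aH sub(6) mH
    by (simp add: nilpotent_subring[OF H(1)] subring_minus[OF H(1)])
  obtain e r s where e: "idempotent_elem (R\<lparr>carrier := H\<rparr>) e"
    and rs: "r \<in> carrier (R\<lparr>carrier := H\<rparr>)" "s \<in> carrier (R\<lparr>carrier := H\<rparr>)"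
    and er: "e = a \<otimes>\<^bsub>R\<lparr>carrier := H\<rparr>\<^esub> r"
    and es: "\<one>\<^bsub>R\<lparr>carrier := H\<rparr>\<^esub> \<ominus>\<^bsub>R\<lparr>carrier := H\<rparr>\<^esub> e
      = (\<one>\<^bsub>R\<lparr>carrier := H\<rparr>\<^esub> \<ominus>\<^bsub>R\<lparr>carrier := H\<rparr>\<^esub> a) \<otimes>\<^bsub>R\<lparr>carrier := H\<rparr>\<^esub> s"
    by (rule C.exchange_of_cube[OF aH nil])
  have eR: "idempotent_elem R e" "e \<in> H" using e by (simp_all add: idempotent_subring[OF H(1)])
  have rsR: "r \<in> carrier R" "s \<in> carrier R" using rs sub(1) by auto
  have "e = a \<otimes> r" using er by simp
  moreover have "\<one> \<ominus> e = (\<one> \<ominus> a) \<otimes> s"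
    using es eR(2) aH sub(3) by (simp add: subring_minus[OF H(1)])
  ultimately show "\<exists>e r s. idempotent_elem R e \<and> r \<in> carrier R \<and> s \<in> carrier R \<and>
      e = a \<otimes> r \<and> \<one> \<ominus> e = (\<one> \<ominus> a) \<otimes> s"
    using eR(1) rsR by blast
qed

text \<open>
  Divide \<open>u\<^sup>3 - u\<close> by \<open>u\<close>, inside a commutative subring.
\<close>

lemma (in ring) unipotent_square_of_cube:
  assumes nil: "nilpotent_elem R (u \<otimes> u \<otimes> u \<ominus> u)" and u: "u \<in> Units R"
  shows "unipotent_elem R (u [^] (2::nat))"
proof -
  have uc: "u \<in> carrier R" using u by (rule Units_closed)
  obtain H where H: "subring H R" "{u} \<subseteq> H" "cring (R\<lparr>carrier := H\<rparr>)"
    and inv: "\<And>u. u \<in> H \<Longrightarrow> u \<in> Units R \<Longrightarrow> inv u \<in> H"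
    by (rule commuting_elements_in_subcring[of "{u}"]) (use uc in auto)
  interpret C: cring "R\<lparr>carrier := H\<rparr>" by (rule H(3))
  note sub = subringE[OF H(1)]
  have uH: "u \<in> H" "inv u \<in> H" using H(2) inv u by auto
  have "u \<otimes> u \<otimes> u \<ominus> u \<in> H" using uH sub(5-7) by (simp add: a_minus_def)
  then have "nilpotent_elem (R\<lparr>carrier := H\<rparr>) ((u \<otimes> u \<otimes> u \<ominus> u) \<otimes> inv u)"
    using C.nilpotent_mult[of "u \<otimes> u \<otimes> u \<ominus> u" "inv u"] nil uH by (simp add: nilpotent_subring[OF H(1)])
  then have "nilpotent_elem R ((u \<otimes> u \<otimes> u \<ominus> u) \<otimes> inv u)" by (simp add: nilpotent_subring[OF H(1)])
  also have "(u \<otimes> u \<otimes> u \<ominus> u) \<otimes> inv u = u \<otimes> u \<otimes> (u \<otimes> inv u) \<ominus> u \<otimes> inv u"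
    using uc Units_inv_closed[OF u] by algebra
  also have "\<dots> = u [^] (2::nat) \<ominus> \<one>" using u uc by (simp add: numeral_2_eq_2)
  finally show ?thesis using uc by (simp add: unipotent_elem_def)
qed

text \<open>
  The hypothesis for \<open>a = 2\<close> makes \<open>6 = 2\<^sup>3 - 2\<close> nilpotent, so the decomposition can be formed in
  a commutative subring containing \<open>a\<close>.
\<close>

lemma (in ring) strongly_2_nil_clean_of_cubes:
  assumes cube: "\<And>a. a \<in> carrier R \<Longrightarrow> nilpotent_elem R (a \<otimes> a \<otimes> a \<ominus> a)"
  shows "strongly_2_nil_clean R"
  unfolding strongly_2_nil_clean_def
proof
  fix a assume a: "a \<in> carrier R"
  obtain H where H: "subring H R" "{a} \<subseteq> H" "cring (R\<lparr>carrier := H\<rparr>)"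
    by (rule commuting_elements_in_subcring[of "{a}"]) (use a in auto)
  interpret C: cring "R\<lparr>carrier := H\<rparr>" by (rule H(3))
  note sub = subringE[OF H(1)]
  have aH: "a \<in> carrier (R\<lparr>carrier := H\<rparr>)" using H(2) by simp
  have mH: "x \<ominus> y \<in> H" if "x \<in> H" "y \<in> H" for x y using that sub(5,7) by (simp add: a_minus_def)
  have nil: "nilpotent_elem (R\<lparr>carrier := H\<rparr>) (a \<otimes>\<^bsub>R\<lparr>carrier := H\<rparr>\<^esub> a \<otimes>\<^bsub>R\<lparr>carrier := H\<rparr>\<^esub> a \<ominus>\<^bsub>R\<lparr>carrier := H\<rparr>\<^esub> a)"
    using cube[OF a] aH sub(6) mH
    by (simp add: nilpotent_subring[OF H(1)] subring_minus[OF H(1)])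
  have "(\<one> \<oplus> \<one>) \<otimes> (\<one> \<oplus> \<one>) \<otimes> (\<one> \<oplus> \<one>) \<ominus> (\<one> \<oplus> \<one>) = (\<one> \<oplus> \<one>) \<otimes> (\<one> \<oplus> \<one> \<oplus> \<one>)"
    by algebra
  then have "nilpotent_elem R ((\<one> \<oplus> \<one>) \<otimes> (\<one> \<oplus> \<one> \<oplus> \<one>))"
    using cube[of "\<one> \<oplus> \<one>"] by simp
  moreover have "(\<one> \<oplus> \<one>) \<otimes> (\<one> \<oplus> \<one> \<oplus> \<one>) \<in> H" using sub(3,6,7) by simp
  ultimately have six: "nilpotent_elem (R\<lparr>carrier := H\<rparr>)
     ((\<one>\<^bsub>R\<lparr>carrier := H\<rparr>\<^esub> \<oplus>\<^bsub>R\<lparr>carrier := H\<rparr>\<^esub> \<one>\<^bsub>R\<lparr>carrier := H\<rparr>\<^esub>) \<otimes>\<^bsub>R\<lparr>carrier := H\<rparr>\<^esub>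
      (\<one>\<^bsub>R\<lparr>carrier := H\<rparr>\<^esub> \<oplus>\<^bsub>R\<lparr>carrier := H\<rparr>\<^esub> \<one>\<^bsub>R\<lparr>carrier := H\<rparr>\<^esub> \<oplus>\<^bsub>R\<lparr>carrier := H\<rparr>\<^esub> \<one>\<^bsub>R\<lparr>carrier := H\<rparr>\<^esub>))"
    by (simp add: nilpotent_subring[OF H(1)])
  obtain e f w where "idempotent_elem (R\<lparr>carrier := H\<rparr>) e" "idempotent_elem (R\<lparr>carrier := H\<rparr>) f"
    "nilpotent_elem (R\<lparr>carrier := H\<rparr>) w" "a = e \<oplus>\<^bsub>R\<lparr>carrier := H\<rparr>\<^esub> f \<oplus>\<^bsub>R\<lparr>carrier := H\<rparr>\<^esub> w"
    by (rule C.decomposition_of_cube[OF aH nil six])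
  then have efw: "idempotent_elem R e" "idempotent_elem R f" "nilpotent_elem R w" "a = e \<oplus> f \<oplus> w"
    and efwH: "e \<in> H" "f \<in> H" "w \<in> H"
    by (simp_all add: nilpotent_subring[OF H(1)] idempotent_subring[OF H(1)])
  have "x \<otimes> y = y \<otimes> x" if "x \<in> H" "y \<in> H" for x y
    using C.m_comm[of x y] that by simp
  then show "\<exists>e f w. idempotent_elem R e \<and> idempotent_elem R f \<and> nilpotent_elem R w \<and>
      e \<otimes> f = f \<otimes> e \<and> e \<otimes> w = w \<otimes> e \<and> f \<otimes> w = w \<otimes> f \<and> a = e \<oplus> f \<oplus> w"
    using efw efwH by blast
qed

theorem corollary5p6:
  fixes R (structure)
  assumes "ring R"
  shows "strongly_2_nil_clean R \<longleftrightarrow>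
    exchange_ring R \<and> (\<forall>u \<in> Units R. unipotent_elem R (u [^] (2::nat)))"
proof -
  interpret ring R by fact
  show ?thesis
  proof
    assume "strongly_2_nil_clean R"
    then have cube: "nilpotent_elem R (a \<otimes> a \<otimes> a \<ominus> a)" if "a \<in> carrier R" for a
      using that by (rule strongly_2_nil_clean_cube)
    show "exchange_ring R \<and> (\<forall>u \<in> Units R. unipotent_elem R (u [^] (2::nat)))"
    proof (intro conjI ballI)
      show "exchange_ring R" by (rule exchange_ring_of_cubes[OF cube])
      show "unipotent_elem R (u [^] (2::nat))" if "u \<in> Units R" for u
        by (rule unipotent_square_of_cube[OF cube[OF Units_closed[OF that]] that])
    qed
  next
    assume "exchange_ring R \<and> (\<forall>u \<in> Units R. unipotent_elem R (u [^] (2::nat)))"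
    then have ex: "exchange_ring R" and sq: "\<forall>u \<in> Units R. unipotent_elem R (u [^] (2::nat))" by auto
    show "strongly_2_nil_clean R"
      by (rule strongly_2_nil_clean_of_cubes[OF cube_sub_self_nilpotent[OF ex sq]])
  qed
qed

end
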